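(* Let $C_{25}$ be the cyclic group of order $25$, let $\rho_6:\mathbb{Z}\to\operatorname{Aut}(C_{25})$ be the homomorphism sending $1$ to the automorphism $\alpha_6$ of $C_{25}$ which maps each element to its $6$-th power, and let $G_6:=C_{25}\rtimes_{\rho_6}\mathbb{Z}$. Then $G_6$ is (isomorphic to) a finite index subgroup of a first order rigid group.
   Context: Two groups are elementarily equivalent if every first order sentence in the language of groups that holds in one also holds in the other. A finitely generated group $\Gamma$ is first order rigid if every finitely generated group that is elementarily equivalent to $\Gamma$ is isomorphic to $\Gamma$. *)

theory Defs
  imports "HOL-Algebra.Algebra" "HOL-Library.Countable_Set"
begin

section \<open>First-order logic in the language of groups\<close>

datatype gterm = Var nat | One | Mult gterm gterm | Inv gterm

instance gterm :: countable
  by countable_datatype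

datatype gform = Eq gterm gterm | Neg gform | Conj gform gform | Forall nat gform

fun tvars :: "gterm \<Rightarrow> nat set" where
  "tvars (Var i) = {i}"
| "tvars One = {}"
| "tvars (Mult s t) = tvars s \<union> tvars t"
| "tvars (Inv t) = tvars t"

fun fvars :: "gform \<Rightarrow> nat set" where
  "fvars (Eq s t) = tvars s \<union> tvars t"
| "fvars (Neg p) = fvars p"
| "fvars (Conj p q) = fvars p \<union> fvars q"
| "fvars (Forall i p) = fvars p - {i}"

definition sentence :: "gform \<Rightarrow> bool" where
  "sentence p \<longleftrightarrow> fvars p = {}"

fun tval :: "('a, 'b) monoid_scheme \<Rightarrow> (nat \<Rightarrow> 'a) \<Rightarrow> gterm \<Rightarrow> 'a" where
  "tval G e (Var i) = e i"
| "tval G e One = \<one>\<^bsub>G\<^esub>"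
| "tval G e (Mult s t) = tval G e s \<otimes>\<^bsub>G\<^esub> tval G e t"
| "tval G e (Inv t) = inv\<^bsub>G\<^esub> (tval G e t)"

fun sat :: "('a, 'b) monoid_scheme \<Rightarrow> (nat \<Rightarrow> 'a) \<Rightarrow> gform \<Rightarrow> bool" where
  "sat G e (Eq s t) \<longleftrightarrow> tval G e s = tval G e t"
| "sat G e (Neg p) \<longleftrightarrow> \<not> sat G e p"
| "sat G e (Conj p q) \<longleftrightarrow> sat G e p \<and> sat G e q"
| "sat G e (Forall i p) \<longleftrightarrow> (\<forall>x\<in>carrier G. sat G (e(i := x)) p)"

text \<open>The truth value of a sentence does not depend on the assignment (lemma \<open>sat_cong\<close>), so
  quantifying over all assignments into the carrier is harmless.\<close>

definition holds_in :: "('a, 'b) monoid_scheme \<Rightarrow> gform \<Rightarrow> bool" where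
  "holds_in G p \<longleftrightarrow> (\<forall>e. range e \<subseteq> carrier G \<longrightarrow> sat G e p)"

definition elem_equiv :: "('a, 'b) monoid_scheme \<Rightarrow> ('c, 'd) monoid_scheme \<Rightarrow> bool" where
  "elem_equiv G H \<longleftrightarrow> (\<forall>p. sentence p \<longrightarrow> (holds_in G p \<longleftrightarrow> holds_in H p))"

section \<open>Finite generation and first order rigidity\<close>

definition fin_gen :: "('a, 'b) monoid_scheme \<Rightarrow> bool" where
  "fin_gen G \<longleftrightarrow> (\<exists>S. finite S \<and> S \<subseteq> carrier G \<and> generate G S = carrier G)"

text \<open>HOL cannot quantify over groups on all types. Since finitely generated groups are
  countable, it is enough to test those whose carrier is a set of natural numbers; the theorem
  \<open>first_order_rigidD\<close> below recovers the condition for groups on an arbitrary type.\<close>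

definition first_order_rigid :: "('a, 'b) monoid_scheme \<Rightarrow> bool" where
  "first_order_rigid G \<longleftrightarrow> group G \<and> fin_gen G \<and>
    (\<forall>H :: nat monoid. group H \<longrightarrow> fin_gen H \<longrightarrow> elem_equiv H G \<longrightarrow> H \<cong> G)"

section \<open>Subgroups of finite index and semidirect products\<close>

definition finite_index_subgroup :: "'a set \<Rightarrow> ('a, 'b) monoid_scheme \<Rightarrow> bool" where
  "finite_index_subgroup H G \<longleftrightarrow> subgroup H G \<and> finite (rcosets\<^bsub>G\<^esub> H)"

definition semidirect ::
  "('a, 'c) monoid_scheme \<Rightarrow> ('b, 'd) monoid_scheme \<Rightarrow> ('b \<Rightarrow> 'a \<Rightarrow> 'a) \<Rightarrow> ('a \<times> 'b) monoid" where
  "semidirect N K \<rho> =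
    \<lparr>carrier = carrier N \<times> carrier K,
     monoid.mult = \<lambda>(n, k) (n', k'). (n \<otimes>\<^bsub>N\<^esub> \<rho> k n', k \<otimes>\<^bsub>K\<^esub> k'),
     one = (\<one>\<^bsub>N\<^esub>, \<one>\<^bsub>K\<^esub>)\<rparr>"

section \<open>The group \<open>C\<^sub>2\<^sub>5 \<rtimes> \<int>\<close>\<close>

abbreviation C25 :: "int monoid" where
  "C25 \<equiv> integer_mod_group 25"

text \<open>Elements of the library's automorphism group are extensional functions, hence the
  restriction to the carrier.\<close>

definition alpha6 :: "int \<Rightarrow> int" where
  "alpha6 = (\<lambda>x\<in>carrier C25. x [^]\<^bsub>C25\<^esub> (6::nat))"

definition rho6 :: "int \<Rightarrow> int \<Rightarrow> int" where
  "rho6 k = alpha6 [^]\<^bsub>AutoGroup C25\<^esub> k"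

definition G6 :: "(int \<times> int) monoid" where
  "G6 = semidirect C25 integer_group rho6"

section \<open>Adequacy of the definitions\<close>

subsection \<open>The action and the semidirect product\<close>

lemma alpha6_auto: "alpha6 \<in> carrier (AutoGroup C25)"
proof -
  have val: "alpha6 x = (6 * x) mod 25" if "x \<in> {0..<25}" for x
    using that by (simp add: alpha6_def carrier_integer_mod_group)
  have "alpha6 \<in> hom C25 C25"
    by (rule homI) (auto simp: carrier_integer_mod_group val mod_simps algebra_simps)
  moreover have "bij_betw alpha6 {0..<25} {0..<25}"
  proof (rule bij_betw_byWitness[where f' = "\<lambda>x. (21 * x) mod 25"])
    have inverse: "21 * (6 * a mod 25) mod 25 = a" "6 * (21 * a mod 25) mod 25 = a"
      if "a \<in> {0..<25}" for a :: int
    proof -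
      have "126 * a mod 25 = (a + 25 * (5 * a)) mod 25" by simp
      also have "\<dots> = a" unfolding mod_mult_self2 using that by simp
      finally show "21 * (6 * a mod 25) mod 25 = a" "6 * (21 * a mod 25) mod 25 = a"
        by (simp_all add: mod_simps)
    qed
    show "\<forall>a\<in>{0..<25}. 21 * alpha6 a mod 25 = a"
      using inverse(1) by (auto simp: val)
    show "\<forall>a\<in>{0..<25}. alpha6 (21 * a mod 25) = a"
      using inverse(2) by (auto simp: val)
  qed (auto simp: val)
  ultimately show ?thesis
    by (simp add: AutoGroup_def auto_def Bij_def carrier_integer_mod_group alpha6_def)
qed

lemma rho6_hom: "rho6 \<in> hom integer_group (AutoGroup C25)"
proof -
  interpret A: group "AutoGroup C25"
    by (simp add: group.AutoGroup)
  have "rho6 = (\<lambda>k::int. alpha6 [^]\<^bsub>AutoGroup C25\<^esub> k)"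
    by (simp add: rho6_def fun_eq_iff)
  then show ?thesis
    using A.hom_integer_group_pow[OF alpha6_auto] by simp
qed

lemma rho6_1: "rho6 1 = alpha6"
proof -
  interpret A: group "AutoGroup C25"
    by (simp add: group.AutoGroup)
  show ?thesis
    unfolding rho6_def using alpha6_auto by (rule A.int_pow_1)
qed

lemma group_semidirect:
  assumes "group N" "group K" and rho: "\<rho> \<in> hom K (AutoGroup N)"
  shows "group (semidirect N K \<rho>)"
proof -
  interpret N: group N by fact
  interpret K: group K by fact
  interpret A: group "AutoGroup N" by (rule N.AutoGroup)
  interpret h: group_hom K "AutoGroup N" \<rho> by unfold_locales (rule rho)
  have aut: "\<rho> k \<in> auto N" if "k \<in> carrier K" for k
    using h.hom_closed[OF that] by (simp add: AutoGroup_def)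
  have cl: "\<rho> k n \<in> carrier N" if "k \<in> carrier K" "n \<in> carrier N" for k n
    using aut[OF that(1)] that(2) by (auto simp: auto_def hom_def)
  have mul: "\<rho> k (m \<otimes>\<^bsub>N\<^esub> n) = \<rho> k m \<otimes>\<^bsub>N\<^esub> \<rho> k n"
    if "k \<in> carrier K" "m \<in> carrier N" "n \<in> carrier N" for k m n
    using aut[OF that(1)] that by (auto simp: auto_def hom_def)
  have comp: "\<rho> (k \<otimes>\<^bsub>K\<^esub> l) n = \<rho> k (\<rho> l n)"
    if "k \<in> carrier K" "l \<in> carrier K" "n \<in> carrier N" for k l n
    using h.hom_mult[OF that(1,2)] aut[OF that(1)] aut[OF that(2)] that(3)
    by (simp add: AutoGroup_def BijGroup_def auto_def compose_def)
  have one: "\<rho> \<one>\<^bsub>K\<^esub> n = n" if "n \<in> carrier N" for n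
    using h.hom_one that by (simp add: AutoGroup_def BijGroup_def)
  show ?thesis
  proof (rule groupI)
    fix x assume "x \<in> carrier (semidirect N K \<rho>)"
    then obtain n k where x: "x = (n, k)" "n \<in> carrier N" "k \<in> carrier K"
      by (auto simp: semidirect_def)
    have ki: "inv\<^bsub>K\<^esub> k \<in> carrier K" using x by simp
    have "\<rho> (inv\<^bsub>K\<^esub> k) \<one>\<^bsub>N\<^esub> \<otimes>\<^bsub>N\<^esub> \<rho> (inv\<^bsub>K\<^esub> k) \<one>\<^bsub>N\<^esub> = \<rho> (inv\<^bsub>K\<^esub> k) \<one>\<^bsub>N\<^esub>"
      using mul[OF ki N.one_closed N.one_closed] by simp
    then have "\<rho> (inv\<^bsub>K\<^esub> k) \<one>\<^bsub>N\<^esub> = \<one>\<^bsub>N\<^esub>"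
      using N.l_cancel_one cl[OF ki N.one_closed] by blast
    then have "\<rho> (inv\<^bsub>K\<^esub> k) (inv\<^bsub>N\<^esub> n) \<otimes>\<^bsub>N\<^esub> \<rho> (inv\<^bsub>K\<^esub> k) n = \<one>\<^bsub>N\<^esub>"
      using mul[OF ki N.inv_closed[OF x(2)] x(2)] N.l_inv[OF x(2)] by metis
    then show "\<exists>y\<in>carrier (semidirect N K \<rho>). y \<otimes>\<^bsub>semidirect N K \<rho>\<^esub> x = \<one>\<^bsub>semidirect N K \<rho>\<^esub>"
      using x ki cl[OF ki N.inv_closed[OF x(2)]]
      by (intro bexI[of _ "(\<rho> (inv\<^bsub>K\<^esub> k) (inv\<^bsub>N\<^esub> n), inv\<^bsub>K\<^esub> k)"])
        (simp_all add: semidirect_def del: h.hom_inv)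
  qed (auto simp: semidirect_def cl mul comp one N.m_assoc K.m_assoc simp del: h.hom_mult h.hom_one)
qed

lemma group_G6: "group G6"
  unfolding G6_def by (rule group_semidirect[OF group_integer_mod_group group_integer_group rho6_hom])

subsection \<open>Satisfaction\<close>

lemma tval_cong: "(\<And>i. i \<in> tvars t \<Longrightarrow> e i = e' i) \<Longrightarrow> tval G e t = tval G e' t"
  by (induction t) auto

lemma sat_cong: "(\<And>i. i \<in> fvars p \<Longrightarrow> e i = e' i) \<Longrightarrow> sat G e p \<longleftrightarrow> sat G e' p"
proof (induction p arbitrary: e e')
  case (Eq s t)
  then show ?case using tval_cong[of s e e' G] tval_cong[of t e e' G] by auto
next
  case (Neg p)
  then show ?case by (metis fvars.simps(2) sat.simps(2))
next
  case (Conj p q)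
  then show ?case by (metis UnCI fvars.simps(3) sat.simps(3))
next
  case (Forall i p)
  have "sat G (e(i := x)) p \<longleftrightarrow> sat G (e'(i := x)) p" for x
    by (rule Forall.IH) (use Forall.prems in auto)
  then show ?case by simp
qed

lemma holds_in_iff_sat:
  assumes "sentence p" "range e \<subseteq> carrier G"
  shows "holds_in G p \<longleftrightarrow> sat G e p"
  unfolding holds_in_def using assms sat_cong[of p _ e G]
  by (metis empty_iff sentence_def)

lemma tval_closed:
  assumes "group G" "range e \<subseteq> carrier G"
  shows "tval G e t \<in> carrier G"
proof -
  interpret group G by fact
  show ?thesis by (induction t) (use assms(2) in auto)
qed

lemma tval_iso:
  assumes "group G" "group H" "f \<in> iso G H" "range e \<subseteq> carrier G"
  shows "tval H (f \<circ> e) t = f (tval G e t)"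
proof -
  interpret group_hom G H f
    using assms by (auto simp: group_hom_def group_hom_axioms_def iso_def)
  show ?thesis
    by (induction t) (simp_all add: tval_closed[OF assms(1,4)])
qed

lemma sat_iso:
  assumes "group G" "group H" "f \<in> iso G H" "range e \<subseteq> carrier G"
  shows "sat H (f \<circ> e) p \<longleftrightarrow> sat G e p"
  using assms(4)
proof (induction p arbitrary: e)
  case (Eq s t)
  have "inj_on f (carrier G)" using assms(3) by (simp add: iso_iff)
  then show ?case
    using Eq by (simp add: tval_iso[OF assms(1-3)] inj_on_eq_iff tval_closed[OF assms(1)] del: comp_apply)
next
  case (Forall i p)
  have *: "sat H ((f \<circ> e)(i := f x)) p \<longleftrightarrow> sat G (e(i := x)) p" if "x \<in> carrier G" for x
  proof -
    have "(f \<circ> e)(i := f x) = f \<circ> e(i := x)" by auto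
    moreover have "range (e(i := x)) \<subseteq> carrier G" using Forall.prems that by auto
    ultimately show ?thesis using Forall.IH by metis
  qed
  have "carrier H = f ` carrier G" using assms(3) by (simp add: iso_iff)
  then have "sat H (f \<circ> e) (Forall i p) \<longleftrightarrow> (\<forall>x\<in>carrier G. sat H ((f \<circ> e)(i := f x)) p)"
    unfolding sat.simps by (metis (no_types, lifting) imageE imageI)
  also have "\<dots> \<longleftrightarrow> (\<forall>x\<in>carrier G. sat G (e(i := x)) p)"
    by (rule ball_cong[OF refl *])
  finally show ?case by (simp only: sat.simps)
qed simp_all

lemma elem_equiv_iso:
  assumes "group G" "group H" "G \<cong> H"
  shows "elem_equiv G H"
  unfolding elem_equiv_def
proof (intro allI impI)
  fix p assume p: "sentence p"
  obtain f where f: "f \<in> iso G H" using assms(3) by (auto simp: is_iso_def)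
  interpret G: group G by fact
  define e where "e = (\<lambda>_::nat. \<one>\<^bsub>G\<^esub>)"
  have e: "range e \<subseteq> carrier G" by (auto simp: e_def)
  then have "range (f \<circ> e) \<subseteq> carrier H" using f by (auto simp: iso_iff)
  then show "holds_in G p \<longleftrightarrow> holds_in H p"
    using holds_in_iff_sat[OF p] e sat_iso[OF assms(1,2) f e] by metis
qed

subsection \<open>Finitely generated groups up to isomorphism\<close>

lemma fin_gen_countable:
  assumes "group G" "fin_gen G"
  shows "countable (carrier G)"
proof -
  interpret group G by fact
  obtain S where S: "finite S" "S \<subseteq> carrier G" "generate G S = carrier G"
    using assms(2) by (auto simp: fin_gen_def)
  define e where "e = from_nat_into (insert \<one>\<^bsub>G\<^esub> S)"
  have e: "range e = insert \<one>\<^bsub>G\<^esub> S"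
    unfolding e_def using S(1) by (intro range_from_nat_into) (auto intro: countable_finite)
  have "generate G S \<subseteq> range (tval G e)"
  proof
    fix x assume "x \<in> generate G S"
    then show "x \<in> range (tval G e)"
    proof induction
      case one
      have "\<one>\<^bsub>G\<^esub> = tval G e One" by simp
      then show ?case by (rule range_eqI)
    next
      case (incl h)
      then obtain i where "h = e i" using e by (metis insertI2 imageE)
      then have "h = tval G e (Var i)" by simp
      then show ?case by (rule range_eqI)
    next
      case (inv h)
      then obtain i where "h = e i" using e by (metis insertI2 imageE)
      then have "inv\<^bsub>G\<^esub> h = tval G e (Inv (Var i))" by simp
      then show ?case by (rule range_eqI)
    next
      case (eng h1 h2)
      then obtain s t where "h1 = tval G e s" "h2 = tval G e t" by blast
      then have "h1 \<otimes>\<^bsub>G\<^esub> h2 = tval G e (Mult s t)" by simp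
      then show ?case by (rule range_eqI)
    qed
  qed
  moreover have "countable (range (tval G e))"
    by (intro countable_image) simp
  ultimately show ?thesis using S(3) countable_subset by metis
qed

lemma fin_gen_iso:
  assumes "group G" "group H" "f \<in> iso G H" "fin_gen G"
  shows "fin_gen H"
proof -
  interpret group_hom G H f
    using assms by (auto simp: group_hom_def group_hom_axioms_def iso_def)
  obtain S where S: "finite S" "S \<subseteq> carrier G" "generate G S = carrier G"
    using assms(4) by (auto simp: fin_gen_def)
  have "f ` carrier G = carrier H" using assms(3) unfolding iso_def bij_betw_def by simp
  have "generate H (f ` S) = f ` generate G S"
    using generate_img[OF S(2)] by simp
  also have "\<dots> = carrier H" unfolding S(3) by fact
  finally have "generate H (f ` S) = carrier H" .
  moreover have "finite (f ` S)" using S(1) by (rule finite_imageI)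
  moreover have "f ` S \<subseteq> carrier H" using S(2) hom_closed by blast
  ultimately show ?thesis
    unfolding fin_gen_def by blast
qed

lemma countable_group_nat_copy:
  assumes "group G" "countable (carrier G)"
  obtains H :: "nat monoid" where "group H" "G \<cong> H"
proof -
  define f where "f = to_nat_on (carrier G)"
  have inj: "inj_on f (carrier G)"
    unfolding f_def by (rule inj_on_to_nat_on) fact
  define H where "H = image_group f G"
  have "f \<in> iso G H"
    unfolding H_def by (rule inj_imp_image_group_iso[OF inj])
  moreover have "group H"
    unfolding H_def by (rule group.inj_imp_image_group_is_group[OF assms(1) inj])
  ultimately show ?thesis
    using that[of H] is_isoI by blast
qed

theorem first_order_rigidD:
  fixes H :: "('c, 'd) monoid_scheme"
  assumes rigid: "first_order_rigid G"
    and H: "group H" "fin_gen H" "elem_equiv H G"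
  shows "H \<cong> G"
proof -
  obtain H' :: "nat monoid" where H': "group H'" "H \<cong> H'"
    using countable_group_nat_copy[OF H(1) fin_gen_countable[OF H(1,2)]] .
  obtain f where "f \<in> iso H H'" using H'(2) by (auto simp: is_iso_def)
  then have "fin_gen H'" by (rule fin_gen_iso[OF H(1) H'(1) _ H(2)])
  moreover have "elem_equiv H' G"
    using elem_equiv_iso[OF H(1) H'] H(3) unfolding elem_equiv_def by metis
  ultimately have "H' \<cong> G"
    using rigid H'(1) unfolding first_order_rigid_def by blast
  with H'(2) show ?thesis by (rule iso_trans)
qed

end

theory Submission
  imports Defs
begin

text \<open>Let \<open>F = C\<^sub>2\<^sub>5 \<rtimes> C\<^sub>5\<close> be the group of order 125 in which \<open>C\<^sub>5\<close> acts through the powers of \<open>\<alpha>\<^sub>6\<close>.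
  Mapping \<open>(n, k)\<close> to \<open>((n, k mod 5), k)\<close> embeds \<open>G\<^sub>6\<close> into \<open>F \<times> \<int>\<close> with index 5, and \<open>F \<times> \<int>\<close> is first
  order rigid. Indeed, first-order sentences force a group \<open>H\<close> elementarily equivalent to \<open>F \<times> \<int>\<close>
  to have a copy of \<open>F\<close> as its set of torsion elements and the map \<open>y \<mapsto> y\<^sup>2\<^sup>5\<close> to be a homomorphism with
  kernel \<open>F\<close> and image \<open>P\<close> in the centre, every value of which is the 25th power of a central element.
  Moreover \<open>P\<close> is torsion-free, and of any two elements and their product one is a square in \<open>P\<close>. If
  \<open>H\<close> is finitely generated, so is \<open>P\<close>, which is therefore infinite cyclic; a central preimage of a
  generator of \<open>P\<close> splits \<open>H\<close> as \<open>F \<times> \<int>\<close>.\<close>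

section \<open>Finitely generated torsion-free abelian groups\<close>

text \<open>Together with \<open>depends_only_on I\<close> for a finite \<open>I\<close>, this makes
  \<open>h\<close> a homomorphism from \<int>^I. Coefficient vectors are total functions, so a
  generator is dropped by shrinking \<open>I\<close> without changing the type.\<close>

definition additive_into :: "('a, 'b) monoid_scheme \<Rightarrow> (('i \<Rightarrow> int) \<Rightarrow> 'a) \<Rightarrow> bool" where
  "additive_into G h \<longleftrightarrow> (\<forall>c. h c \<in> carrier G) \<and>
    (\<forall>c d. h (\<lambda>i. c i + d i) = h c \<otimes>\<^bsub>G\<^esub> h d)"

definition depends_only_on :: "'i set \<Rightarrow> (('i \<Rightarrow> int) \<Rightarrow> 'a) \<Rightarrow> bool" where
  "depends_only_on I h \<longleftrightarrow> (\<forall>c d. (\<forall>i\<in>I. c i = d i) \<longrightarrow> h c = h d)"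

lemma additive_closed: "additive_into G h \<Longrightarrow> h c \<in> carrier G"
  by (simp add: additive_into_def)

lemma additive_add: "additive_into G h \<Longrightarrow> h (\<lambda>i. c i + d i) = h c \<otimes>\<^bsub>G\<^esub> h d"
  by (simp add: additive_into_def)

lemma depends_only_onD:
  "depends_only_on I h \<Longrightarrow> (\<And>i. i \<in> I \<Longrightarrow> c i = d i) \<Longrightarrow> h c = h d"
  unfolding depends_only_on_def by blast

lemma (in group) additive_zero:
  assumes "additive_into G h"
  shows "h (\<lambda>_. 0) = \<one>"
proof -
  have "h (\<lambda>_. 0) \<otimes> h (\<lambda>_. 0) = h (\<lambda>_. 0)"
    using additive_add[OF assms, of "\<lambda>_. 0" "\<lambda>_. 0"] by simp
  then show ?thesis using additive_closed[OF assms] by (simp add: l_cancel_one)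
qed

lemma (in group) additive_int_multiple:
  assumes "additive_into G h"
  shows "h (\<lambda>i. k * c i) = h c [^] k"
proof -
  have nat: "h (\<lambda>i. int n * c i) = h c [^] n" for n
  proof (induction n)
    case 0
    show ?case using additive_zero[OF assms] by simp
  next
    case (Suc n)
    have "h (\<lambda>i. int (Suc n) * c i) = h (\<lambda>i. int n * c i + c i)"
      by (simp add: algebra_simps)
    also have "\<dots> = h c [^] Suc n"
      using additive_add[OF assms, of "\<lambda>i. int n * c i" c] Suc by simp
    finally show ?case .
  qed
  show ?thesis
  proof (cases "k \<ge> 0")
    case True
    then show ?thesis using nat[of "nat k"] by (metis int_nat_eq int_pow_int)
  next
    case False
    have "h (\<lambda>i. k * c i) \<otimes> h (\<lambda>i. - k * c i) = \<one>"
      using additive_add[OF assms, of "\<lambda>i. k * c i" "\<lambda>i. - k * c i"] additive_zero[OF assms]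
      by simp
    then have "h (\<lambda>i. k * c i) = inv (h (\<lambda>i. - k * c i))"
      using additive_closed[OF assms] by (simp add: inv_equality)
    moreover have "h (\<lambda>i. - k * c i) = h c [^] nat (- k)"
      using nat[of "nat (- k)"] False by (simp only: int_nat_eq) simp
    ultimately have "h (\<lambda>i. k * c i) = inv (h c [^] nat (- k))" by (simp only:)
    then show ?thesis unfolding int_pow_def2 using False by (simp only: if_True not_le)
  qed
qed

lemma (in group) pow_nat_abs_eq_one:
  assumes "x \<in> carrier G" "x [^] (k::int) = \<one>"
  shows "x [^] nat \<bar>k\<bar> = \<one>"
  using assms int_pow_def2[of G x k]
  by (cases "k < 0")
    (auto simp only: if_True if_False abs_of_neg abs_of_nonneg not_less nat_pow_closed inv_eq_1_iff)

text \<open>A relation \<open>c\<close> in the kernel is shortened by elementary changes of coordinates until only one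
  coefficient is left; torsion-freeness then makes the corresponding generator superfluous.\<close>

lemma (in group) additive_drop_coordinate:
  assumes fin: "finite I" and h: "additive_into G h" "depends_only_on I h" "range h = A"
    and torsion_free: "\<And>x m. x \<in> A \<Longrightarrow> m > 0 \<Longrightarrow> x [^] (m::nat) = \<one> \<Longrightarrow> x = \<one>"
    and rel: "h c = \<one>" "i \<in> I" "c i \<noteq> 0"
  shows "\<exists>j\<in>I. \<exists>h' :: ('i \<Rightarrow> int) \<Rightarrow> 'a. additive_into G h' \<and> depends_only_on (I - {j}) h' \<and> range h' = A"
  using h rel
proof (induction "nat (\<Sum>i\<in>I. \<bar>c i\<bar>)" arbitrary: h c i rule: less_induct)
  case (less c h i)
  note h = less.prems(1-3)
  show ?case
  proof (cases "\<exists>j\<in>I. j \<noteq> i \<and> c j \<noteq> 0")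
    \<comment> \<open>Only \<open>c i\<close> is nonzero on \<open>I\<close>, so the relation says
      that a nontrivial power of the generator \<open>h ?e\<close> is the identity.\<close>
    case False
    let ?e = "\<lambda>j. if j = i then 1 else 0 :: int"
    have "\<one> = h (\<lambda>j. c i * ?e j)"
      unfolding less.prems(4)[symmetric] by (rule depends_only_onD[OF h(2)]) (use False in auto)
    also have "\<dots> = h ?e [^] c i" by (rule additive_int_multiple[OF h(1)])
    finally have e1: "h ?e [^] c i = \<one>" by simp
    have "h ?e [^] nat \<bar>c i\<bar> = \<one>"
      by (rule pow_nat_abs_eq_one[OF additive_closed[OF h(1)] e1])
    moreover have "h ?e \<in> A" unfolding h(3)[symmetric] by (rule rangeI)
    ultimately have e: "h ?e = \<one>"
      using less.prems(6) by (intro torsion_free[of "h ?e" "nat \<bar>c i\<bar>"]) simp_all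
    have "h c = h d" if "\<And>j. j \<in> I - {i} \<Longrightarrow> c j = d j" for c d
    proof -
      have "h c = h (\<lambda>j. d j + (c i - d i) * ?e j)"
        by (rule depends_only_onD[OF h(2)]) (use that in auto)
      also have "\<dots> = h d \<otimes> h ?e [^] (c i - d i)"
        using additive_add[OF h(1), of d "\<lambda>j. (c i - d i) * ?e j"]
          additive_int_multiple[OF h(1), of "c i - d i" ?e] by (simp only:)
      finally show ?thesis using e additive_closed[OF h(1), of d] by simp
    qed
    then have "depends_only_on (I - {i}) h" unfolding depends_only_on_def by blast
    then show ?thesis using h less.prems(5) by blast
  next
    case True
    then obtain p q where pq: "p \<in> I" "q \<in> I" "p \<noteq> q" "c p \<noteq> 0" "c q \<noteq> 0" "\<bar>c q\<bar> \<le> \<bar>c p\<bar>"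
      using less.prems(5,6) by (metis nle_le)
    \<comment> \<open>\<open>s * c q\<close> has the sign of \<open>c p\<close> and at most its
      absolute value, so subtracting it strictly shortens \<open>c p\<close>.\<close>
    define s where "s = sgn (c p) * sgn (c q)"
    \<comment> \<open>An invertible change of coordinates with \<open>E c' = c\<close>: the shorter
      \<open>c'\<close> is a relation for \<open>h \<circ> E\<close>, which has the same
      image.\<close>
    define E where "E = (\<lambda>d. d(p := d p + s * d q))"
    define c' where "c' = c(p := c p - s * c q)"
    have small: "\<bar>c' p\<bar> < \<bar>c p\<bar>"
      using pq by (auto simp: c'_def s_def sgn_if)
    have "(\<Sum>i\<in>I. \<bar>c' i\<bar>) < (\<Sum>i\<in>I. \<bar>c i\<bar>)"
    proof (rule sum_strict_mono_ex1)
      show "\<forall>x\<in>I. \<bar>c' x\<bar> \<le> \<bar>c x\<bar>" using small by (auto simp: c'_def)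
      show "\<exists>x\<in>I. \<bar>c' x\<bar> < \<bar>c x\<bar>" using small pq(1) by auto
    qed (rule fin)
    moreover have "0 \<le> (\<Sum>i\<in>I. \<bar>c' i\<bar>)" by (rule sum_nonneg) simp
    ultimately have lt: "nat (\<Sum>i\<in>I. \<bar>c' i\<bar>) < nat (\<Sum>i\<in>I. \<bar>c i\<bar>)" by linarith
    show ?thesis
    \<comment> \<open>The index is now \<open>q\<close>, since \<open>c' p\<close> may have become 0
      whereas \<open>c' q = c q\<close>.\<close>
    proof (rule less.hyps[OF lt, of "h \<circ> E" q])
      have "E c' = c" using pq(3) by (auto simp: E_def c'_def fun_eq_iff)
      then show "(h \<circ> E) c' = \<one>" using less.prems(4) by simp
      show "c' q \<noteq> 0" using pq by (simp add: c'_def)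
      have E: "E (\<lambda>i. c i + d i) = (\<lambda>i. E c i + E d i)" for c d
        by (auto simp: E_def fun_eq_iff algebra_simps)
      show "additive_into G (h \<circ> E)"
        unfolding additive_into_def comp_apply E
        using additive_closed[OF h(1)] additive_add[OF h(1)] by blast
      have "(h \<circ> E) c = (h \<circ> E) d" if "\<forall>i\<in>I. c i = d i" for c d
        unfolding comp_apply
        by (rule depends_only_onD[OF h(2)]) (use that pq in \<open>auto simp: E_def\<close>)
      then show "depends_only_on I (h \<circ> E)" by (simp add: depends_only_on_def)
      have "E (d(p := d p - s * d q)) = d" for d
        using pq(3) by (auto simp: E_def fun_eq_iff)
      then have "surj E" by (metis surj_def)
      then show "range (h \<circ> E) = A" using h(3) by (metis image_comp)
    qed fact
  qed
qed

lemma (in group) cyclic_if_additive_image: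
  fixes h :: "('i \<Rightarrow> int) \<Rightarrow> 'a"
  assumes h: "additive_into G h" "depends_only_on I h" "range h = A" and fin: "finite I"
    and torsion_free: "\<And>x m. x \<in> A \<Longrightarrow> m > 0 \<Longrightarrow> x [^] (m::nat) = \<one> \<Longrightarrow> x = \<one>"
    and parity: "\<And>x y. x \<in> A \<Longrightarrow> y \<in> A \<Longrightarrow>
      \<exists>z\<in>A. x = z \<otimes> z \<or> y = z \<otimes> z \<or> x \<otimes> y = z \<otimes> z"
  shows "\<exists>t\<in>A. A = range (\<lambda>k::int. t [^] k)"
  using h fin
proof (induction "card I" arbitrary: I h rule: less_induct)
  case (less I h)
  note h = less.prems(1-3)
  have descent: ?case if rel: "h c = \<one>" "i \<in> I" "c i \<noteq> 0" for c i
  proof -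
    have ex: "\<exists>j\<in>I. \<exists>h' :: ('i \<Rightarrow> int) \<Rightarrow> 'a. additive_into G h' \<and>
        depends_only_on (I - {j}) h' \<and> range h' = A"
      by (rule additive_drop_coordinate[OF less.prems(4) h _ rel]) (rule torsion_free)
    obtain j and h' :: "('i \<Rightarrow> int) \<Rightarrow> 'a" where "j \<in> I" "additive_into G h'"
      "depends_only_on (I - {j}) h'" "range h' = A"
      using ex by blast
    then show ?thesis
      using less.hyps[of "I - {j}" h'] less.prems(4) by (meson card_Diff1_less finite_Diff)
  qed
  show ?case
  proof (cases "\<exists>p\<in>I. \<exists>q\<in>I. p \<noteq> q")
    case True
    then obtain p q where pq: "p \<in> I" "q \<in> I" "p \<noteq> q" by blast
    define e where "e i = (\<lambda>j. if j = i then 1 else 0 :: int)" for i :: 'i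
    obtain d where "h (e p) = h d \<otimes> h d \<or> h (e q) = h d \<otimes> h d
      \<or> h (e p) \<otimes> h (e q) = h d \<otimes> h d"
      using parity[of "h (e p)" "h (e q)"] h(3) by blast
    then obtain f i where f: "h f = h d \<otimes> h d" "i \<in> I" "odd (f i)"
    proof (elim disjE)
      assume "h (e p) \<otimes> h (e q) = h d \<otimes> h d"
      then have "h (\<lambda>i. e p i + e q i) = h d \<otimes> h d"
        using additive_add[OF h(1), of "e p" "e q"] by simp
      then show ?thesis using that[of "\<lambda>i. e p i + e q i" p] pq by (simp add: e_def)
    qed (use that[of "e p" p] that[of "e q" q] pq in \<open>auto simp: e_def\<close>)
    \<comment> \<open>\<open>r\<close> is -2d, so \<open>f + r\<close> is a relation with odd
      coefficient at \<open>i\<close>; the factor \<open>- 1\<close> fits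
      \<open>additive_int_multiple\<close>.\<close>
    define r where "r = (\<lambda>j. - 1 * (d j + d j))"
    have "h r = inv (h d \<otimes> h d)"
      unfolding r_def additive_int_multiple[OF h(1)] additive_add[OF h(1)]
      using additive_closed[OF h(1), of d] by (simp add: int_pow_neg)
    then have "h (\<lambda>j. f j + r j) = \<one>"
      unfolding additive_add[OF h(1)] f(1) using additive_closed[OF h(1), of d] by simp
    moreover have "f i + r i \<noteq> 0" using f(3) unfolding r_def by presburger
    ultimately show ?thesis using descent[of "\<lambda>j. f j + r j" i] f(2) by blast
  next
    case False
    \<comment> \<open>This includes the empty \<open>I\<close>, where \<open>i\<close> is arbitrary
      and \<open>h e\<close> is the identity.\<close>
    then obtain i where i: "I \<subseteq> {i}" by blast
    define e where "e = (\<lambda>j. if j = i then 1 else 0 :: int)"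
    have "h c = h e [^] c i" for c
    proof -
      have "h c = h (\<lambda>j. c i * e j)"
        by (rule depends_only_onD[OF h(2)]) (use i in \<open>auto simp: e_def\<close>)
      then show ?thesis unfolding additive_int_multiple[OF h(1)] .
    qed
    moreover have "h e [^] k \<in> range h" for k :: int
      unfolding additive_int_multiple[OF h(1), symmetric] by blast
    ultimately have "range h = range (\<lambda>k::int. h e [^] k)" by blast
    then show ?thesis using h(3) by blast
  qed
qed

text \<open>A coefficient vector, indexed by \<open>S\<close> itself, goes to the product of the
  corresponding powers; commutativity makes this additive.\<close>

lemma (in comm_group) additive_onto_if_finitely_generated:
  assumes "finite S" "S \<subseteq> carrier G" "generate G S = carrier G"
  obtains h where "additive_into G h" "depends_only_on S h" "range h = carrier G"
proof
  define h where "h c = (\<Otimes>s\<in>S. s [^] c s)" for c :: "'a \<Rightarrow> int"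
  have cl: "h c \<in> carrier G" for c
    unfolding h_def by (rule finprod_closed) (use assms(2) in auto)
  have add: "h (\<lambda>i. c i + d i) = h c \<otimes> h d" for c d
  proof -
    have "h (\<lambda>i. c i + d i) = (\<Otimes>s\<in>S. s [^] c s \<otimes> s [^] d s)"
      unfolding h_def by (rule finprod_cong') (use assms(2) in \<open>auto simp: int_pow_mult\<close>)
    also have "\<dots> = h c \<otimes> h d"
      unfolding h_def by (rule finprod_multf) (use assms(2) in auto)
    finally show ?thesis .
  qed
  then show h: "additive_into G h" using cl by (simp add: additive_into_def)
  have "h c = h d" if "\<forall>i\<in>S. c i = d i" for c d
    unfolding h_def by (rule finprod_cong') (use assms(2) that in auto)
  then show "depends_only_on S h" by (simp add: depends_only_on_def)
  have single: "h (\<lambda>j. if j = s then k else 0) = s [^] k" if "s \<in> S" for s k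
  proof -
    have "h (\<lambda>j. if j = s then k else 0) = (\<Otimes>j\<in>S. if s = j then s [^] k else \<one>)"
      unfolding h_def by (rule finprod_cong') (use assms(2) in auto)
    also have "\<dots> = s [^] k"
      using finprod_singleton[OF that assms(1), of "\<lambda>_. s [^] k"] assms(2) that by auto
    finally show ?thesis .
  qed
  have "x \<in> range h" if "x \<in> generate G S" for x
    using that
  proof induction
    case one
    show ?case using additive_zero[OF h] by (metis rangeI)
  next
    case (incl s)
    then show ?case using single[of s 1] assms(2) by (metis int_pow_1 rangeI subsetD)
  next
    case (inv s)
    then have "h (\<lambda>j. if j = s then -1 else 0) = inv s"
      using single[of s "-1"] assms(2) by (auto simp: int_pow_neg)
    then show ?case by (metis rangeI)
  next
    case (eng x y)
    then obtain c d where "x = h c" "y = h d" by blast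
    then have "x \<otimes> y = h (\<lambda>i. c i + d i)" by (simp add: add)
    then show ?case by simp
  qed
  then show "range h = carrier G" using cl assms(3) by blast
qed

text \<open>Parity says that the squares have index at most two, which excludes free abelian groups
  of rank two or more.\<close>

lemma (in comm_group) cyclic_if_torsion_free_parity:
  assumes "fin_gen G"
    and torsion_free: "\<And>x m. x \<in> carrier G \<Longrightarrow> m > 0 \<Longrightarrow> x [^] (m::nat) = \<one> \<Longrightarrow> x = \<one>"
    and parity: "\<And>x y. x \<in> carrier G \<Longrightarrow> y \<in> carrier G \<Longrightarrow>
      \<exists>z\<in>carrier G. x = z \<otimes> z \<or> y = z \<otimes> z \<or> x \<otimes> y = z \<otimes> z"
  shows "\<exists>t\<in>carrier G. carrier G = range (\<lambda>k::int. t [^] k)"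
proof -
  obtain S where S: "finite S" "S \<subseteq> carrier G" "generate G S = carrier G"
    using assms(1) by (auto simp: fin_gen_def)
  obtain h where h: "additive_into G h" "depends_only_on S h" "range h = carrier G"
    using additive_onto_if_finitely_generated[OF S] .
  show ?thesis
    by (rule cyclic_if_additive_image[OF h S(1)]) (rule torsion_free parity; assumption)+
qed

section \<open>The group \<open>(C\<^sub>2\<^sub>5 \<rtimes> C\<^sub>5) \<times> \<int>\<close>\<close>

text \<open>The factor \<open>1 + 5 * j\<close> is \<open>6 ^ j\<close> modulo 25, that is, \<open>C\<^sub>5\<close> acts through the powers of \<open>\<alpha>\<^sub>6\<close>.\<close>

definition F125Z :: "(int \<times> int \<times> int) monoid" where
  "F125Z = \<lparr>carrier = {0..<25} \<times> {0..<5} \<times> UNIV,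
    monoid.mult = \<lambda>(i, j, k) (i', j', k'). ((i + (1 + 5 * j) * i') mod 25, (j + j') mod 5, k + k'),
    one = (0, 0, 0)\<rparr>"

lemma carrier_F125Z: "carrier F125Z = {0..<25} \<times> {0..<5} \<times> UNIV"
  by (simp add: F125Z_def)

lemma one_F125Z: "\<one>\<^bsub>F125Z\<^esub> = (0, 0, 0)"
  by (simp add: F125Z_def)

lemma mult_F125Z:
  "(i, j, k) \<otimes>\<^bsub>F125Z\<^esub> (i', j', k') = ((i + (1 + 5 * j) * i') mod 25, (j + j') mod 5, k + k')"
  by (simp add: F125Z_def)

text \<open>The factor depends modulo 25 only on \<open>j\<close> modulo 5, so the action of the
  cyclic group of order 5 is well defined.\<close>

lemma five_mult_mod: "(x + (1 + 5 * (j mod 5)) * i) mod 25 = (x + (1 + 5 * j) * i) mod (25 :: int)"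
proof -
  have "x + (1 + 5 * (5 * q + r)) * i = x + (1 + 5 * r) * i + 25 * (q * i)" for q r
    by (simp add: algebra_simps)
  from this[of "j div 5" "j mod 5"]
  have "x + (1 + 5 * j) * i = x + (1 + 5 * (j mod 5)) * i + 25 * (j div 5 * i)"
    by (simp only: mult_div_mod_eq)
  then show ?thesis by (simp only: mod_mult_self2)
qed

text \<open>Associativity comes from (1 + 5b)(1 + 5e) = 1 + 5(b + e) + 25be: modulo 25,
  \<open>1 + 5 * j\<close> takes sums to products.\<close>

lemma group_F125Z: "group F125Z"
proof (rule groupI)
  fix x y z :: "int \<times> int \<times> int"
  obtain a b c where x: "x = (a, b, c)" by (rule prod_cases3)
  obtain d e f where y: "y = (d, e, f)" by (rule prod_cases3)
  obtain g h i where z: "z = (g, h, i)" by (rule prod_cases3)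
  have "(a + (1 + 5 * b) * d + (1 + 5 * (b + e)) * g) mod 25
    = (a + (1 + 5 * b) * (d + (1 + 5 * e) * g)) mod 25"
  proof -
    have "a + (1 + 5 * b) * (d + (1 + 5 * e) * g)
      = a + (1 + 5 * b) * d + (1 + 5 * (b + e)) * g + 25 * (b * e * g)"
      by (simp add: algebra_simps)
    then show ?thesis by (simp only: mod_mult_self2)
  qed
  then have "((a + (1 + 5 * b) * d) mod 25 + (1 + 5 * ((b + e) mod 5)) * g) mod 25
    = (a + (1 + 5 * b) * ((d + (1 + 5 * e) * g) mod 25)) mod 25"
    unfolding five_mult_mod by (metis mod_add_left_eq mod_add_right_eq mod_mult_right_eq)
  then show "x \<otimes>\<^bsub>F125Z\<^esub> y \<otimes>\<^bsub>F125Z\<^esub> z = x \<otimes>\<^bsub>F125Z\<^esub> (y \<otimes>\<^bsub>F125Z\<^esub> z)"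
    by (simp add: x y z mult_F125Z mod_simps add.assoc)
next
  fix x assume "x \<in> carrier F125Z"
  then obtain i j k where x: "x = (i, j, k)" "i \<in> {0..<25}" "j \<in> {0..<5}"
    by (cases x) (auto simp: carrier_F125Z)
  \<comment> \<open>By the same congruence \<open>1 - 5 * j\<close> inverts \<open>1 + 5 * j\<close>
    modulo 25.\<close>
  let ?y = "((- (1 - 5 * j) * i) mod 25, (- j) mod 5, - k)"
  have "((- (1 - 5 * j) * i) mod 25 + (1 + 5 * ((- j) mod 5)) * i) mod 25
    = (- (1 - 5 * j) * i + (1 + 5 * (- j)) * i) mod 25"
    unfolding five_mult_mod by (rule mod_add_left_eq)
  also have "\<dots> = 0" by (simp add: algebra_simps)
  finally have "?y \<otimes>\<^bsub>F125Z\<^esub> x = \<one>\<^bsub>F125Z\<^esub>"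
    by (simp add: x mult_F125Z one_F125Z mod_simps)
  moreover have "?y \<in> carrier F125Z" by (simp add: carrier_F125Z)
  ultimately show "\<exists>y\<in>carrier F125Z. y \<otimes>\<^bsub>F125Z\<^esub> x = \<one>\<^bsub>F125Z\<^esub>" by blast
qed (auto simp: carrier_F125Z mult_F125Z one_F125Z)

interpretation F125Z: group F125Z
  by (rule group_F125Z)

text \<open>The first coordinate adds up the twisted copies \<open>(1 + 5 * j * m) * i\<close> for
  \<open>m < n\<close>.\<close>

lemma pow_F125Z:
  assumes "(i, j, k) \<in> carrier F125Z"
  shows "(i, j, k) [^]\<^bsub>F125Z\<^esub> (n::nat) = (i * (int n + 5 * j * (\<Sum>m<n. int m)) mod 25, int n * j mod 5, int n * k)"
proof (induction n)
  case 0
  show ?case by (simp add: one_F125Z)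
next
  case (Suc n)
  let ?S = "\<Sum>m<n. int m"
  have "(i * (int n + 5 * j * ?S) mod 25 + (1 + 5 * (int n * j mod 5)) * i) mod 25
    = (i * (int n + 5 * j * ?S) + (1 + 5 * (int n * j)) * i) mod 25"
    unfolding five_mult_mod by (rule mod_add_left_eq)
  also have "i * (int n + 5 * j * ?S) + (1 + 5 * (int n * j)) * i
    = i * (int (Suc n) + 5 * j * (\<Sum>m<Suc n. int m))"
    by (simp add: algebra_simps)
  finally show ?case
    by (simp add: Suc mult_F125Z mod_simps algebra_simps)
qed

text \<open>The finite factor has exponent 25, because the sum 300 of the numbers below 25 is
  divisible by 5. Hence 25th powers see only the integer coordinate.\<close>

lemma pow25_F125Z:
  assumes "(i, j, k) \<in> carrier F125Z"
  shows "(i, j, k) [^]\<^bsub>F125Z\<^esub> (25::nat) = (0, 0, 25 * k)"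
proof -
  have "(\<Sum>m<25. int m) = 300" by (simp add: eval_nat_numeral)
  then have "i * (int 25 + 5 * j * (\<Sum>m<25. int m)) = 25 * (i * (1 + 60 * j))"
    by (simp add: algebra_simps)
  then have "i * (int 25 + 5 * j * (\<Sum>m<25. int m)) mod 25 = 0" by presburger
  then show ?thesis unfolding pow_F125Z[OF assms] by simp
qed

lemma pow_F125Z_base:
  "i \<in> {0..<25} \<Longrightarrow> (i, 0, 0) [^]\<^bsub>F125Z\<^esub> (n::nat) = (i * int n mod 25, 0, 0)"
  "j \<in> {0..<5} \<Longrightarrow> (0, j, 0) [^]\<^bsub>F125Z\<^esub> (n::nat) = (0, int n * j mod 5, 0)"
  by (simp_all add: pow_F125Z carrier_F125Z)

lemma int_pow_F125Z: "(0, 0, 1) [^]\<^bsub>F125Z\<^esub> (k::int) = (0, 0, k)"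
proof -
  have t: "(0, 0, 1) \<in> carrier F125Z" by (simp add: carrier_F125Z)
  have n: "(0, 0, 1) [^]\<^bsub>F125Z\<^esub> (n::nat) = (0, 0, int n)" for n
    by (simp add: pow_F125Z[OF t])
  have "inv\<^bsub>F125Z\<^esub> (0, 0, - k) = (0, 0, k)"
    by (rule F125Z.inv_equality) (auto simp: mult_F125Z one_F125Z carrier_F125Z)
  then show ?thesis
    using n[of "nat k"] n[of "nat (- k)"] by (simp add: int_pow_def2)
qed

lemma F125Z_normal_form:
  assumes "(i, j, k) \<in> carrier F125Z"
  shows "(i, j, k) = (1, 0, 0) [^]\<^bsub>F125Z\<^esub> nat i \<otimes>\<^bsub>F125Z\<^esub> (0, 1, 0) [^]\<^bsub>F125Z\<^esub> nat j \<otimes>\<^bsub>F125Z\<^esub> (0, 0, 1) [^]\<^bsub>F125Z\<^esub> k"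
proof -
  have "(1, 0, 0) [^]\<^bsub>F125Z\<^esub> nat i = (i, 0, 0)" "(0, 1, 0) [^]\<^bsub>F125Z\<^esub> nat j = (0, j, 0)"
    using assms by (subst pow_F125Z_base; simp add: carrier_F125Z)+
  then show ?thesis using assms unfolding int_pow_F125Z by (simp only: mult_F125Z) (simp add: carrier_F125Z)
qed

lemma fin_gen_F125Z: "fin_gen F125Z"
proof -
  let ?S = "{(1, 0, 0), (0, 1, 0), (0, 0, 1)} :: (int \<times> int \<times> int) set"
  have S: "?S \<subseteq> carrier F125Z" by (simp add: carrier_F125Z)
  interpret S: subgroup "generate F125Z ?S" F125Z
    by (rule F125Z.generate_is_subgroup[OF S])
  have mem: "x [^]\<^bsub>F125Z\<^esub> (n::int) \<in> generate F125Z ?S" if "x \<in> ?S" for x n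
    by (rule F125Z.subgroup_int_pow_closed[OF S.subgroup_axioms]) (rule generate.incl[OF that])
  have "x \<in> generate F125Z ?S" if x: "x \<in> carrier F125Z" for x
  proof -
    obtain i j k where ijk: "x = (i, j, k)" by (rule prod_cases3)
    have "x = (1, 0, 0) [^]\<^bsub>F125Z\<^esub> int (nat i) \<otimes>\<^bsub>F125Z\<^esub> (0, 1, 0) [^]\<^bsub>F125Z\<^esub> int (nat j) \<otimes>\<^bsub>F125Z\<^esub> (0, 0, 1) [^]\<^bsub>F125Z\<^esub> k"
      using F125Z_normal_form x unfolding ijk int_pow_int by blast
    also have "\<dots> \<in> generate F125Z ?S"
      by (intro S.m_closed mem) auto
    finally show ?thesis .
  qed
  then show ?thesis
    unfolding fin_gen_def using S F125Z.generate_incl[OF S] by (intro exI[of _ ?S]) auto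
qed

section \<open>The action of \<open>rho6\<close> and the embedding of \<open>G6\<close> with finite
  index\<close>

text \<open>By the binomial theorem 6^k is 1 + 5k modulo 25. The induction runs in both directions
  from 0, since \<open>k\<close> may be negative.\<close>

lemma rho6_apply:
  assumes "n \<in> {0..<25}"
  shows "rho6 k n = (1 + 5 * k) * n mod 25"
proof -
  interpret A: group "AutoGroup C25" by (simp add: group.AutoGroup)
  interpret h: group_hom integer_group "AutoGroup C25" rho6
    
    by (intro group_hom.intro group_hom_axioms.intro rho6_hom group_integer_group A.is_group)
  have aut: "rho6 k \<in> auto C25" for k
    using h.hom_closed[of k] by (simp add: AutoGroup_def)
  have comp: "rho6 (k + l) x = rho6 k (rho6 l x)" if "x \<in> {0..<25}" for k l x
    using h.hom_mult[of k l] aut[of k] aut[of l] that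
    by (simp add: AutoGroup_def BijGroup_def auto_def compose_def carrier_integer_mod_group)
  have one: "rho6 1 x = 6 * x mod 25" if "x \<in> {0..<25}" for x
    using that by (simp add: rho6_1 alpha6_def carrier_integer_mod_group)
  have cl: "rho6 k x \<in> {0..<25}" if "x \<in> {0..<25}" for k x
    using aut[of k] that unfolding auto_def hom_def Pi_def carrier_integer_mod_group by auto
  show ?thesis
  proof (induction k rule: int_induct[of _ 0])
    case base
    show ?case
      using h.hom_one assms by (simp add: AutoGroup_def BijGroup_def carrier_integer_mod_group)
  next
    case (step1 k)
    have "rho6 (1 + k) n = 6 * ((1 + 5 * k) * n mod 25) mod 25"
      using comp[OF assms, of 1 k] one[OF cl[OF assms, of k]] step1(2) by (simp only: add.commute)
    also have "\<dots> = 6 * ((1 + 5 * k) * n) mod 25" by (rule mod_mult_right_eq)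
    also have "6 * ((1 + 5 * k) * n) = (1 + 5 * (k + 1)) * n + 25 * (k * n)"
      by (simp add: algebra_simps)
    finally show ?case unfolding mod_mult_self2 by (simp only: add.commute)
  next
    case (step2 k)
    have "rho6 (1 + (k - 1)) n = 6 * rho6 (k - 1) n mod 25"
      using comp[OF assms, of 1 "k - 1"] one[OF cl[OF assms]] by simp
    then have "6 * rho6 (k - 1) n mod 25 = (1 + 5 * k) * n mod 25" using step2 by simp
    \<comment> \<open>21 inverts 6 modulo 25, so the factor 6 can be cancelled.\<close>
    then have "21 * (6 * rho6 (k - 1) n) mod 25 = 21 * ((1 + 5 * k) * n) mod 25"
      by (metis mod_mult_right_eq)
    moreover have "21 * (6 * rho6 (k - 1) n) = rho6 (k - 1) n + 25 * (5 * rho6 (k - 1) n)" by simp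
    moreover have "21 * ((1 + 5 * k) * n) = (1 + 5 * (k - 1)) * n + 25 * (n + 4 * k * n)"
      by (simp add: algebra_simps)
    ultimately show ?case using cl[OF assms, of "k - 1"] by (simp only: mod_mult_self2) simp
  qed
qed

definition G6_emb :: "int \<times> int \<Rightarrow> int \<times> int \<times> int" where
  "G6_emb = (\<lambda>(n, k). (n, k mod 5, k))"

lemma carrier_G6: "carrier G6 = {0..<25} \<times> UNIV"
  by (simp add: G6_def semidirect_def carrier_integer_mod_group)

lemma mult_G6:
  "n' \<in> {0..<25} \<Longrightarrow> (n, k) \<otimes>\<^bsub>G6\<^esub> (n', k') = ((n + (1 + 5 * k) * n') mod 25, k + k')"
  by (simp add: G6_def semidirect_def rho6_apply mod_simps)

text \<open>The fifth power of \<open>alpha6\<close> is the identity, so \<open>k\<close> and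
  \<open>k mod 5\<close> act alike on \<open>C25\<close>; this is
  \<open>five_mult_mod\<close>.\<close>

lemma G6_emb_hom: "G6_emb \<in> hom G6 F125Z"
proof (rule homI)
  fix x y assume "x \<in> carrier G6" "y \<in> carrier G6"
  then show "G6_emb (x \<otimes>\<^bsub>G6\<^esub> y) = G6_emb x \<otimes>\<^bsub>F125Z\<^esub> G6_emb y"
    by (auto simp: G6_emb_def carrier_G6 mult_G6 mult_F125Z five_mult_mod mod_simps)
qed (auto simp: G6_emb_def carrier_G6 carrier_F125Z)

lemma inj_G6_emb: "inj_on G6_emb (carrier G6)"
  by (auto simp: G6_emb_def inj_on_def)

text \<open>Dividing \<open>(i, j, k)\<close> by the element \<open>(i, k mod 5, k)\<close> of the
  image leaves \<open>(0, (j - k) mod 5, 0)\<close>, so five elements represent all right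
  cosets.\<close>

lemma finite_index_G6_emb: "finite_index_subgroup (G6_emb ` carrier G6) F125Z"
proof -
  let ?H = "G6_emb ` carrier G6"
  interpret G6: group G6 by (rule group_G6)
  interpret h: group_hom G6 F125Z G6_emb by unfold_locales (rule G6_emb_hom)
  have sub: "subgroup ?H F125Z" by (rule h.img_is_subgroup)
  have "?H #>\<^bsub>F125Z\<^esub> x \<in> (\<lambda>j. ?H #>\<^bsub>F125Z\<^esub> (0, j, 0)) ` {0..<5}" if mem: "x \<in> carrier F125Z" for x
  proof -
    obtain i j k where x: "x = (i, j, k)" "i \<in> {0..<25}" "j \<in> {0..<5}"
      using mem by (cases x) (auto simp: carrier_F125Z)
    have "(i, k mod 5, k) \<in> ?H" using x(2) by (force simp: carrier_G6 G6_emb_def)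
    moreover have "x = (i, k mod 5, k) \<otimes>\<^bsub>F125Z\<^esub> (0, (j - k) mod 5, 0)"
      using x by (simp add: mult_F125Z mod_simps)
    ultimately have "x \<in> ?H #>\<^bsub>F125Z\<^esub> (0, (j - k) mod 5, 0)" by (auto simp: r_coset_def)
    then have "?H #>\<^bsub>F125Z\<^esub> x = ?H #>\<^bsub>F125Z\<^esub> (0, (j - k) mod 5, 0)"
      using F125Z.repr_independence[OF _ _ sub] by (simp add: carrier_F125Z)
    then show ?thesis by simp
  qed
  then have "rcosets\<^bsub>F125Z\<^esub> ?H \<subseteq> (\<lambda>j. ?H #>\<^bsub>F125Z\<^esub> (0, j, 0)) ` {0..<5}"
    by (auto simp: RCOSETS_def)
  then show ?thesis
    unfolding finite_index_subgroup_def using sub finite_subset by blast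
qed

section \<open>Recognising the group\<close>

lemma (in monoid) nat_pow_mod:
  assumes "x \<in> carrier G" "x [^] m = \<one>"
  shows "x [^] (n mod m) = x [^] (n :: nat)"
proof -
  have "x [^] n = x [^] (m * (n div m) + n mod m)" by simp
  also have "\<dots> = (x [^] m) [^] (n div m) \<otimes> x [^] (n mod m)"
    using assms(1) by (simp only: nat_pow_mult nat_pow_pow)
  finally show ?thesis using assms by simp
qed

lemma (in group) eq_one_if_coprime_exponents:
  assumes "x \<in> carrier G" "x [^] m = \<one>" "x [^] n = \<one>" "coprime m (n :: nat)"
  shows "x = \<one>"
proof -
  have "ord x dvd m" "ord x dvd n" using assms(1-3) by (simp_all add: pow_eq_id)
  then have "ord x = 1" using assms(4) coprime_common_divisor_nat by blast
  then show ?thesis using assms(1) ord_eq_1 by blast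
qed

text \<open>The order of \<open>x\<close> is a power of \<open>p\<close> smaller than
  \<open>p\<^sup>2\<close>, so it divides \<open>p\<close>. For \<open>p = 5\<close>, an element
  with trivial 25th but nontrivial 5th power thus has order exactly 25.\<close>

lemma (in group) pow_p_eq_one_if_small_exponent:
  assumes "x \<in> carrier G" "x [^] (p\<^sup>2) = \<one>" "x [^] n = \<one>" "0 < n" "n < p\<^sup>2" and p: "Factorial_Ring.prime (p :: nat)"
  shows "x [^] p = \<one>"
proof -
  have "ord x dvd p\<^sup>2" "ord x dvd n" using assms(1-3) by (simp_all add: pow_eq_id)
  then obtain i where i: "i \<le> 2" "ord x = p ^ i" "p ^ i < p\<^sup>2"
    using divides_primepow_nat[OF p] dvd_imp_le assms(4,5) by (metis le_less_trans)
  then have "i \<le> 1" using prime_gt_1_nat[OF p] by (cases "i = 2") auto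
  then have "ord x dvd p" using i(2) by (cases i) auto
  then show ?thesis using assms(1) by (simp add: pow_eq_id)
qed

lemma (in monoid) pow_commutes:
  assumes "x \<in> carrier G" "w \<in> carrier G" "x \<otimes> w = w \<otimes> x"
  shows "x [^] (n::nat) \<otimes> w = w \<otimes> x [^] n"
proof (induction n)
  case (Suc n)
  have "x [^] Suc n \<otimes> w = (x [^] n \<otimes> w) \<otimes> x" using assms by (simp add: m_assoc)
  also have "\<dots> = w \<otimes> x [^] Suc n" unfolding Suc using assms by (simp add: m_assoc)
  finally show ?case .
qed (use assms in simp)

lemma (in group) inv_commutes:
  assumes "x \<in> carrier G" "w \<in> carrier G" "x \<otimes> w = w \<otimes> x"
  shows "inv x \<otimes> w = w \<otimes> inv x"
proof -
  have "w = x \<otimes> (w \<otimes> inv x)" using assms by (simp add: m_assoc[symmetric]) (simp add: m_assoc)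
  then show ?thesis using assms inv_solve_left[of "w \<otimes> inv x" x w] by simp
qed

lemma (in group) int_pow_commutes:
  assumes "x \<in> carrier G" "w \<in> carrier G" "x \<otimes> w = w \<otimes> x"
  shows "x [^] (k::int) \<otimes> w = w \<otimes> x [^] k"
proof (cases k)
  case (nonneg n)
  then show ?thesis using pow_commutes[OF assms] by (simp only: int_pow_int)
next
  case (neg n)
  then show ?thesis
    using inv_commutes[OF nat_pow_closed[OF assms(1)] assms(2) pow_commutes[OF assms]] assms(1)
    by (simp only: int_pow_neg_int)
qed

lemma carrier_update: "carrier (G\<lparr>carrier := A\<rparr>) = A"
  by simp

text \<open>All hypotheses except \<open>fg\<close> are expressible by first-order sentences,
  \<open>exponent\<close> by one for each \<open>m\<close>. The isomorphism follows the normal form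
  of \<open>F125Z\<close>: it sends \<open>(i, j, k)\<close> to a^i b^j t^k, where \<open>t\<close>
  is central and its 25th power generates the group \<open>P\<close> of 25th powers.\<close>

lemma (in group) F125Z_iso:
  assumes fg: "fin_gen G"
    and a: "a \<in> carrier G" "a [^] (25::nat) = \<one>" "a [^] (5::nat) \<noteq> \<one>"
    and b: "b \<in> carrier G" "b [^] (5::nat) = \<one>" "b \<otimes> a = a [^] (6::nat) \<otimes> b"
    and torsion: "\<And>y. y \<in> carrier G \<Longrightarrow> y [^] (25::nat) = \<one> \<Longrightarrow>
      \<exists>i<25. \<exists>j<5. y = a [^] (i::nat) \<otimes> b [^] (j::nat)"
    and pow_mult: "\<And>x y. x \<in> carrier G \<Longrightarrow> y \<in> carrier G \<Longrightarrow>
      (x \<otimes> y) [^] (25::nat) = x [^] (25::nat) \<otimes> y [^] (25::nat)"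
    and central: "\<And>y. y \<in> carrier G \<Longrightarrow>
      \<exists>z\<in>carrier G. z [^] (25::nat) = y [^] (25::nat) \<and> (\<forall>w\<in>carrier G. z \<otimes> w = w \<otimes> z)"
    and parity: "\<And>x y. x \<in> carrier G \<Longrightarrow> y \<in> carrier G \<Longrightarrow>
      \<exists>z\<in>carrier G. x [^] (25::nat) = (z \<otimes> z) [^] (25::nat) \<or> y [^] (25::nat) = (z \<otimes> z) [^] (25::nat)
        \<or> (x \<otimes> y) [^] (25::nat) = (z \<otimes> z) [^] (25::nat)"
    and exponent: "\<And>y m. y \<in> carrier G \<Longrightarrow> m > 0 \<Longrightarrow> y [^] (m::nat) = \<one> \<Longrightarrow> y [^] (25::nat) = \<one>"
    and infinite: "\<exists>y\<in>carrier G. y [^] (25::nat) \<noteq> \<one>"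
  shows "F125Z \<cong> G"
proof -
  define q where "q y = y [^] (25::nat)" for y
  define P where "P = q ` carrier G"
  interpret q: group_hom G G q
  proof (intro group_hom.intro group_hom_axioms.intro is_group homI)
    show "q (x \<otimes> y) = q x \<otimes> q y" if "x \<in> carrier G" "y \<in> carrier G" for x y
      unfolding q_def using that by (rule pow_mult)
  qed (simp add: q_def)
  have P: "subgroup P G" unfolding P_def by (rule q.img_is_subgroup)
  have P_central: "x \<otimes> w = w \<otimes> x" if xw: "x \<in> P" "w \<in> carrier G" for x w
  proof -
    obtain y where "y \<in> carrier G" "x = y [^] (25::nat)"
      using xw(1) unfolding P_def q_def by blast
    then obtain z where z: "z \<in> carrier G" "x = z [^] (25::nat)" "\<forall>w\<in>carrier G. z \<otimes> w = w \<otimes> z"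
      using central[of y] by metis
    then show ?thesis using pow_commutes[OF z(1) xw(2)] xw(2) by blast
  qed
  interpret P: group "G\<lparr>carrier := P\<rparr>"
    by (rule subgroup.subgroup_is_group[OF P is_group])
  interpret P: comm_group "G\<lparr>carrier := P\<rparr>"
    by (rule P.group_comm_groupI) (use P_central subgroup.subset[OF P] in auto)
  have fgP: "fin_gen (G\<lparr>carrier := P\<rparr>)"
  proof -
    interpret qP: group_hom G "G\<lparr>carrier := P\<rparr>" q
      by (intro group_hom.intro group_hom_axioms.intro is_group P.is_group homI) (auto simp: P_def)
    obtain S where S: "finite S" "S \<subseteq> carrier G" "generate G S = carrier G"
      using fg by (auto simp: fin_gen_def)
    have "generate (G\<lparr>carrier := P\<rparr>) (q ` S) = carrier (G\<lparr>carrier := P\<rparr>)"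
      using qP.generate_img[OF S(2)] S(3) by (simp add: P_def)
    then show ?thesis
      unfolding fin_gen_def using S(1,2) by (intro exI[of _ "q ` S"]) (auto simp: P_def)
  qed
  \<comment> \<open>If \<open>y [^] 25\<close> is torsion, so is \<open>y\<close>, and then
    \<open>exponent\<close> gives \<open>y [^] 25 = \<one>\<close>.\<close>
  have P_torsion_free: "x = \<one>\<^bsub>G\<lparr>carrier := P\<rparr>\<^esub>"
    if x: "x \<in> carrier (G\<lparr>carrier := P\<rparr>)" "m > 0" "x [^]\<^bsub>G\<lparr>carrier := P\<rparr>\<^esub> m = \<one>\<^bsub>G\<lparr>carrier := P\<rparr>\<^esub>"
    for x and m :: nat
  proof -
    obtain y where y: "y \<in> carrier G" "x = y [^] (25::nat)" using x(1) by (auto simp: P_def q_def)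
    have "y [^] (25 * m) = \<one>"
      using x(3) y by (simp add: nat_pow_consistent[symmetric] nat_pow_pow)
    then show ?thesis using exponent[of y "25 * m"] y x(2) by simp
  qed
  have P_parity: "\<exists>z\<in>carrier (G\<lparr>carrier := P\<rparr>). x = z \<otimes>\<^bsub>G\<lparr>carrier := P\<rparr>\<^esub> z \<or>
        y = z \<otimes>\<^bsub>G\<lparr>carrier := P\<rparr>\<^esub> z \<or> x \<otimes>\<^bsub>G\<lparr>carrier := P\<rparr>\<^esub> y = z \<otimes>\<^bsub>G\<lparr>carrier := P\<rparr>\<^esub> z"
    if "x \<in> carrier (G\<lparr>carrier := P\<rparr>)" "y \<in> carrier (G\<lparr>carrier := P\<rparr>)" for x y
  proof -
    from that obtain x' y' where xy: "x' \<in> carrier G" "x = q x'" "y' \<in> carrier G" "y = q y'"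
      by (auto simp: P_def)
    obtain z where z: "z \<in> carrier G" "q x' = q (z \<otimes> z) \<or> q y' = q (z \<otimes> z) \<or> q (x' \<otimes> y') = q (z \<otimes> z)"
      using parity[OF xy(1,3)] unfolding q_def by blast
    then have "q z \<in> P" "x = q z \<otimes> q z \<or> y = q z \<otimes> q z \<or> x \<otimes> y = q z \<otimes> q z"
      using xy by (auto simp: P_def)
    then show ?thesis by auto
  qed
  \<comment> \<open>Finite generation enters here: it passes from \<open>G\<close> to its image
    \<open>P\<close>, which is therefore cyclic.\<close>
  obtain u where u: "u \<in> P" "P = range (\<lambda>k::int. u [^] k)"
  proof -
    have "\<exists>u\<in>carrier (G\<lparr>carrier := P\<rparr>). carrier (G\<lparr>carrier := P\<rparr>) = range (\<lambda>k::int. u [^]\<^bsub>G\<lparr>carrier := P\<rparr>\<^esub> k)"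
      using fgP P_torsion_free P_parity by (rule P.cyclic_if_torsion_free_parity)
    then obtain u where uP: "u \<in> P" "P = range (\<lambda>k::int. u [^]\<^bsub>G\<lparr>carrier := P\<rparr>\<^esub> k)"
      unfolding carrier_update by blast
    from uP(2) have "P = range (\<lambda>k::int. u [^] k)"
      by (simp only: int_pow_consistent[OF P uP(1), symmetric])
    with uP(1) show thesis by (rule that)
  qed
  obtain t where t: "t \<in> carrier G" "q t = u" and tc: "\<And>w. w \<in> carrier G \<Longrightarrow> t \<otimes> w = w \<otimes> t"
  proof -
    have "u \<in> q ` carrier G" using u(1) by (simp only: P_def)
    then obtain y where y: "u = q y" "y \<in> carrier G" by (rule imageE)
    then obtain z where "z \<in> carrier G" "q z = u" "\<forall>w\<in>carrier G. z \<otimes> w = w \<otimes> z"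
      using central[OF y(2)] unfolding q_def by auto
    then show thesis using that by blast
  qed
  have tk_central: "t [^] k \<otimes> w = w \<otimes> t [^] k" if "w \<in> carrier G" for k :: int and w
    using int_pow_commutes[OF t(1) that tc[OF that]] .
  have q_tk: "q (t [^] k) = u [^] k" for k :: int
    using q.hom_int_pow[of t k] t by simp
  \<comment> \<open>If \<open>t\<close> were torsion, then \<open>u\<close> and hence
    \<open>P\<close> would be trivial, against \<open>infinite\<close>.\<close>
  have t_inf: "k = 0" if "t [^] k = \<one>" for k :: int
  proof (rule ccontr)
    assume "k \<noteq> 0"
    then have "q t = \<one>"
      using exponent[of t "nat \<bar>k\<bar>"] pow_nat_abs_eq_one[OF t(1) that] t(1) by (simp add: q_def)
    then have "P = {\<one>}" using u(2) t(2) by auto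
    then show False using infinite by (auto simp: P_def q_def)
  qed
  have ba: "b \<otimes> a [^] n = a [^] (6 * n) \<otimes> b" for n :: nat
  proof (induction n)
    case (Suc n)
    have "b \<otimes> a [^] Suc n = (b \<otimes> a [^] n) \<otimes> a" using a b by (simp add: m_assoc)
    also have "\<dots> = a [^] (6 * n) \<otimes> (b \<otimes> a)" using a b by (simp only: Suc m_assoc nat_pow_closed)
    also have "\<dots> = (a [^] (6 * n) \<otimes> a [^] (6::nat)) \<otimes> b"
      using a b by (simp only: b(3) m_assoc nat_pow_closed)
    also have "\<dots> = a [^] (6 * Suc n) \<otimes> b" using a by (simp add: nat_pow_mult add.commute)
    finally show ?case .
  qed (use a b in simp)
  \<comment> \<open>Conjugation by \<open>b [^] m\<close> raises powers of \<open>a\<close> to the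
    exponent 6^m, which is 1 + 5m modulo 25; the surplus multiple of 25 vanishes because
    \<open>a [^] 25 = \<one>\<close>.\<close>
  have comm: "b [^] m \<otimes> a [^] n = a [^] ((1 + 5 * m) * n) \<otimes> b [^] m" for m n :: nat
  proof (induction m arbitrary: n)
    case (Suc m)
    have "b [^] Suc m \<otimes> a [^] n = b [^] m \<otimes> (b \<otimes> a [^] n)" using a b by (simp add: m_assoc)
    also have "\<dots> = (b [^] m \<otimes> a [^] (6 * n)) \<otimes> b"
      using a b by (simp only: ba m_assoc nat_pow_closed)
    also have "\<dots> = a [^] ((1 + 5 * m) * (6 * n)) \<otimes> b [^] Suc m"
      using a b by (simp add: Suc m_assoc)
    also have "(1 + 5 * m) * (6 * n) = (1 + 5 * Suc m) * n + 25 * (m * n)"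
      by (simp add: algebra_simps)
    also have "a [^] \<dots> = a [^] ((1 + 5 * Suc m) * n)"
      using nat_pow_mod[OF a(1,2)] by (metis mod_mult_self2)
    finally show ?case .
  qed (use a b in simp)
  define f where "f = (\<lambda>(i, j, k). a [^] nat i \<otimes> b [^] nat j \<otimes> t [^] (k::int))"
  have f_closed: "f x \<in> carrier G" for x
    using a b t by (simp add: f_def split: prod.split)
  have f_nat: "f (int n, int m, k) = a [^] n \<otimes> b [^] m \<otimes> t [^] k" for n m k
    by (simp add: f_def)
  \<comment> \<open>Exponents may be left unreduced, so that products in \<open>F125Z\<close> are
    compared by plain exponent arithmetic.\<close>
  have f_mod: "f (int n mod 25, int m mod 5, k) = a [^] n \<otimes> b [^] m \<otimes> t [^] k" for n m k
  proof -
    have "nat (int n mod 25) = n mod 25" "nat (int m mod 5) = m mod 5"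
      by (simp_all add: nat_mod_distrib)
    then show ?thesis
      using nat_pow_mod[OF a(1,2), of n] nat_pow_mod[OF b(1,2), of m] by (simp add: f_def)
  qed
  have f_hom: "f \<in> hom F125Z G"
  proof (rule homI)
    fix x y assume "x \<in> carrier F125Z" "y \<in> carrier F125Z"
    then obtain i j k i' j' k' where xy: "x = (int i, int j, k)" "y = (int i', int j', k')"
      unfolding carrier_F125Z by (auto simp: elim!: nonneg_int_cases)
    have "f (x \<otimes>\<^bsub>F125Z\<^esub> y) = f (int (i + (1 + 5 * j) * i') mod 25, int (j + j') mod 5, k + k')"
      by (simp add: xy mult_F125Z distrib_right)
    also have "\<dots> = a [^] (i + (1 + 5 * j) * i') \<otimes> b [^] (j + j') \<otimes> t [^] (k + k')"
      by (rule f_mod)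
    \<comment> \<open>The exponents are split so that \<open>comm\<close>, read backwards, yields
      \<open>b [^] j \<otimes> a [^] i'\<close>; moving the central \<open>t [^] k\<close> then
      separates \<open>f x\<close> from \<open>f y\<close>.\<close>
    also have "\<dots> = a [^] i \<otimes> (a [^] ((1 + 5 * j) * i') \<otimes> b [^] j) \<otimes> b [^] j' \<otimes> (t [^] k \<otimes> t [^] k')"
      unfolding nat_pow_mult[OF a(1), symmetric] nat_pow_mult[OF b(1), symmetric] int_pow_mult[OF t(1)]
      using a(1) b(1) t(1) by (simp only: m_assoc nat_pow_closed int_pow_closed m_closed)
    also have "\<dots> = a [^] i \<otimes> (b [^] j \<otimes> a [^] i') \<otimes> b [^] j' \<otimes> (t [^] k \<otimes> t [^] k')"
      by (simp only: comm)
    also have "\<dots> = (a [^] i \<otimes> b [^] j) \<otimes> ((a [^] i' \<otimes> b [^] j') \<otimes> t [^] k) \<otimes> t [^] k'"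
      using a(1) b(1) t(1) by (simp only: m_assoc nat_pow_closed int_pow_closed m_closed)
    also have "(a [^] i' \<otimes> b [^] j') \<otimes> t [^] k = t [^] k \<otimes> (a [^] i' \<otimes> b [^] j')"
      by (rule tk_central[symmetric]) (use a b in simp)
    also have "(a [^] i \<otimes> b [^] j) \<otimes> (t [^] k \<otimes> (a [^] i' \<otimes> b [^] j')) \<otimes> t [^] k' = f x \<otimes> f y"
      unfolding xy f_nat using a(1) b(1) t(1) by (simp only: m_assoc nat_pow_closed int_pow_closed m_closed)
    finally show "f (x \<otimes>\<^bsub>F125Z\<^esub> y) = f x \<otimes> f y" .
  qed (rule f_closed)
  interpret f: group_hom F125Z G f
    by (intro group_hom.intro group_hom_axioms.intro is_group group_F125Z f_hom)
  \<comment> \<open>Applying \<open>q\<close> leaves only t^(25k), so \<open>k = 0\<close>. Then b^m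
    is a power of \<open>a\<close> and commutes with \<open>a\<close>, which by \<open>comm\<close>
    gives a^(5m) = 1 and forces \<open>m = 0\<close>; finally a^n = 1 forces
    \<open>n = 0\<close>.\<close>
  have "x = \<one>\<^bsub>F125Z\<^esub>" if x: "x \<in> carrier F125Z" "f x = \<one>" for x
  proof -
    obtain n m k where nmk: "x = (int n, int m, k)" "n < 25" "m < 5"
      using x(1) unfolding carrier_F125Z by (auto elim!: nonneg_int_cases)
    have "q (a [^] n) = \<one>" "q (b [^] m) = \<one>"
    proof -
      have "q (a [^] n) = (a [^] (25::nat)) [^] n" "q (b [^] m) = (b [^] (5::nat)) [^] (5 * m)"
        using a(1) b(1) by (simp_all add: q_def nat_pow_pow mult.commute)
      then show "q (a [^] n) = \<one>" "q (b [^] m) = \<one>" using a(2) b(2) by simp_all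
    qed
    then have "q (t [^] k) = q (f x)" using a b t by (simp add: nmk(1) f_nat)
    then have "t [^] (k * 25) = \<one>"
      using x(2) t(1) int_pow_pow[of t k 25] int_pow_int[of G "t [^] k" 25] by (simp add: q_def)
    then have k: "k = 0" using t_inf by fastforce
    then have ab: "a [^] n \<otimes> b [^] m = \<one>" using x(2) a b by (simp add: nmk(1) f_nat)
    have "m = 0"
    proof (rule ccontr)
      assume "m \<noteq> 0"
      have "b [^] m = inv (a [^] n)" using inv_equality[OF ab] a b by (metis inv_inv nat_pow_closed)
      moreover have "inv (a [^] n) \<otimes> a = a \<otimes> inv (a [^] n)"
        using inv_commutes[of "a [^] n" a] a(1) pow_commutes[of a a n] by simp
      ultimately have "a \<otimes> b [^] m = a [^] (1 + 5 * m) \<otimes> b [^] m"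
        using comm[of m 1] a(1) by simp
      then have "a [^] (1 + 5 * m) = a" using a(1) b(1) by simp
      then have "(a [^] (5::nat)) [^] m = \<one>"
        using a(1) by (simp add: nat_pow_pow nat_pow_Suc2 del: nat_pow_Suc)
      moreover have "(a [^] (5::nat)) [^] (5::nat) = \<one>" using a by (simp add: nat_pow_pow)
      moreover have "coprime m 5"
      proof -
        have "\<not> 5 dvd m" using \<open>m \<noteq> 0\<close> nmk(3) by (auto dest: dvd_imp_le)
        then have "coprime 5 m" by (intro prime_imp_coprime) auto
        then show ?thesis by (simp only: coprime_commute)
      qed
      ultimately have "a [^] (5::nat) = \<one>"
        using eq_one_if_coprime_exponents[of "a [^] (5::nat)" m 5] a(1) nat_pow_closed by blast
      then show False using a(3) by simp
    qed
    have "n = 0"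
    proof (rule ccontr)
      assume "n \<noteq> 0"
      moreover have "a [^] n = \<one>" using ab \<open>m = 0\<close> a(1) by simp
      moreover have "a [^] ((5::nat)\<^sup>2) = \<one>" "n < 5\<^sup>2" using a(2) nmk(2) by simp_all
      moreover have "Factorial_Ring.prime (5::nat)" by simp
      ultimately have "a [^] (5::nat) = \<one>"
        using pow_p_eq_one_if_small_exponent[OF a(1), of 5 n] by blast
      then show False using a(3) by simp
    qed
    then show ?thesis using k \<open>m = 0\<close> by (simp add: nmk(1) one_F125Z)
  qed
  then have inj: "inj_on f (carrier F125Z)"
    by (intro f.inj_on_one_iff[THEN iffD2]) auto
  \<comment> \<open>A suitable \<open>k\<close> is read off \<open>q y\<close>; dividing
    \<open>y\<close> by t^k gives an element killed by \<open>q\<close>, to which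
    \<open>torsion\<close> applies.\<close>
  have "y \<in> f ` carrier F125Z" if y: "y \<in> carrier G" for y
  proof -
    obtain k :: int where k: "q y = u [^] k"
      using u(2) y unfolding P_def by blast
    have "q (y \<otimes> inv (t [^] k)) = \<one>"
      using y t(1) k q_tk[of k] q.hom_closed[of "t [^] k"] by (simp add: r_inv)
    then have "\<exists>i<25. \<exists>j<5. y \<otimes> inv (t [^] k) = a [^] (i::nat) \<otimes> b [^] (j::nat)"
      by (intro torsion) (use y t(1) in \<open>simp_all add: q_def\<close>)
    then obtain i j where ij: "i < 25" "j < 5" "y \<otimes> inv (t [^] k) = a [^] (i::nat) \<otimes> b [^] (j::nat)"
      by blast
    then have "y = f (int i, int j, k)"
      unfolding f_nat ij(3)[symmetric] using y t(1) by (simp add: m_assoc)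
    moreover have "(int i, int j, k) \<in> carrier F125Z" using ij by (simp add: carrier_F125Z)
    ultimately show ?thesis by blast
  qed
  then have "f ` carrier F125Z = carrier G" using f_closed by auto
  then have "f \<in> iso F125Z G" using f_hom inj by (simp add: iso_def bij_betw_def)
  then show ?thesis by (rule is_isoI)
qed

section \<open>Transfer along elementary equivalence\<close>

primrec Pow :: "gterm \<Rightarrow> nat \<Rightarrow> gterm" where
  "Pow t 0 = One"
| "Pow t (Suc n) = Mult (Pow t n) t"

definition Disj :: "gform \<Rightarrow> gform \<Rightarrow> gform" where
  "Disj p q = Neg (Conj (Neg p) (Neg q))"

definition Ex :: "nat \<Rightarrow> gform \<Rightarrow> gform" where
  "Ex i p = Neg (Forall i (Neg p))"

primrec Disjs :: "gform list \<Rightarrow> gform" where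
  "Disjs [] = Neg (Eq One One)"
| "Disjs (p # ps) = Disj p (Disjs ps)"

lemma tval_Pow [simp]: "tval G e (Pow t n) = tval G e t [^]\<^bsub>G\<^esub> n"
  by (induction n) simp_all

text \<open>Equality can fail at exponent 0, where the power is \<open>One\<close>.\<close>

lemma tvars_Pow: "tvars (Pow t n) \<subseteq> tvars t"
  by (induction n) simp_all

lemma sat_Disj [simp]: "sat G e (Disj p q) \<longleftrightarrow> sat G e p \<or> sat G e q"
  by (simp add: Disj_def)

lemma sat_Ex [simp]: "sat G e (Ex i p) \<longleftrightarrow> (\<exists>x\<in>carrier G. sat G (e(i := x)) p)"
  by (simp add: Ex_def)

lemma sat_Disjs [simp]: "sat G e (Disjs ps) \<longleftrightarrow> (\<exists>p\<in>set ps. sat G e p)"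
  by (induction ps) simp_all

lemma fvars_Disj [simp]: "fvars (Disj p q) = fvars p \<union> fvars q"
  by (simp add: Disj_def)

lemma fvars_Ex [simp]: "fvars (Ex i p) = fvars p - {i}"
  by (simp add: Ex_def)

lemma fvars_Disjs: "fvars (Disjs ps) = (\<Union>p\<in>set ps. fvars p)"
  by (induction ps) simp_all

lemma elem_equiv_sat_iff:
  assumes "group G" "group H" "elem_equiv H G" "fvars p = {}"
  shows "sat H (\<lambda>_. \<one>\<^bsub>H\<^esub>) p \<longleftrightarrow> sat G (\<lambda>_. \<one>\<^bsub>G\<^esub>) p"
proof -
  interpret G: group G by fact
  interpret H: group H by fact
  have p: "sentence p" using assms(4) by (simp add: sentence_def)
  have "holds_in G p \<longleftrightarrow> sat G (\<lambda>_. \<one>\<^bsub>G\<^esub>) p" "holds_in H p \<longleftrightarrow> sat H (\<lambda>_. \<one>\<^bsub>H\<^esub>) p"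
    by (rule holds_in_iff_sat[OF p]; auto)+
  then show ?thesis using assms(3) p by (simp add: elem_equiv_def)
qed

section \<open>Sentences satisfied by \<open>F125Z\<close>\<close>

text \<open>A presentation of \<open>F\<close>: variable 0 is a generator \<open>a\<close> of order
  25, variable 1 a generator \<open>b\<close> with b a b^-1 = a^6, and the disjunction lists the 125
  normal forms. That these are distinct is derived in \<open>F125Z_iso\<close>.\<close>

definition torsion_sentence :: gform where
  "torsion_sentence = Ex 0 (Ex 1
    (Conj (Eq (Pow (Var 0) 25) One)
    (Conj (Neg (Eq (Pow (Var 0) 5) One))
    (Conj (Eq (Pow (Var 1) 5) One)
    (Conj (Eq (Mult (Var 1) (Var 0)) (Mult (Pow (Var 0) 6) (Var 1)))
    (Forall 2 (Disj (Neg (Eq (Pow (Var 2) 25) One))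
      (Disjs (map (\<lambda>(i, j). Eq (Var 2) (Mult (Pow (Var 0) i) (Pow (Var 1) j)))
        (List.product [0..<25] [0..<5]))))))))))"

lemma fvars_torsion_sentence: "fvars torsion_sentence = {}"
  using tvars_Pow by (fastforce simp: torsion_sentence_def fvars_Disjs simp del: set_upt upt.simps)

lemma sat_torsion_sentence:
  "sat G e torsion_sentence \<longleftrightarrow> (\<exists>a\<in>carrier G. \<exists>b\<in>carrier G.
    a [^]\<^bsub>G\<^esub> (25::nat) = \<one>\<^bsub>G\<^esub> \<and> a [^]\<^bsub>G\<^esub> (5::nat) \<noteq> \<one>\<^bsub>G\<^esub> \<and> b [^]\<^bsub>G\<^esub> (5::nat) = \<one>\<^bsub>G\<^esub> \<and>
    b \<otimes>\<^bsub>G\<^esub> a = a [^]\<^bsub>G\<^esub> (6::nat) \<otimes>\<^bsub>G\<^esub> b \<and>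
    (\<forall>y\<in>carrier G. y [^]\<^bsub>G\<^esub> (25::nat) = \<one>\<^bsub>G\<^esub> \<longrightarrow>
      (\<exists>i<25. \<exists>j<5. y = a [^]\<^bsub>G\<^esub> (i::nat) \<otimes>\<^bsub>G\<^esub> b [^]\<^bsub>G\<^esub> (j::nat))))"
proof -
  have Bex: "(\<exists>p\<in>set (List.product [0..<25] [0..<5]). P p) \<longleftrightarrow> (\<exists>i<25. \<exists>j<5. P (i, j))" for P
    unfolding set_product set_upt atLeast0LessThan by blast
  show ?thesis
    unfolding torsion_sentence_def
    by (simp add: Bex case_prod_unfold disj_imp del: set_product)
qed

lemma torsion_sentence_F125Z: "sat F125Z e torsion_sentence"
proof -
  let ?a = "(1, 0, 0) :: int \<times> int \<times> int" and ?b = "(0, 1, 0) :: int \<times> int \<times> int"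
  have gens: "?a \<in> carrier F125Z" "?b \<in> carrier F125Z" by (simp_all add: carrier_F125Z)
  have "\<exists>i<25. \<exists>j<5. y = ?a [^]\<^bsub>F125Z\<^esub> (i::nat) \<otimes>\<^bsub>F125Z\<^esub> ?b [^]\<^bsub>F125Z\<^esub> (j::nat)"
    if y: "y \<in> carrier F125Z" "y [^]\<^bsub>F125Z\<^esub> (25::nat) = \<one>\<^bsub>F125Z\<^esub>" for y
  proof -
    obtain i j k where ijk: "y = (i, j, k)" by (rule prod_cases3)
    have "k = 0" using y by (simp add: ijk pow25_F125Z one_F125Z)
    have "?a [^]\<^bsub>F125Z\<^esub> nat i \<otimes>\<^bsub>F125Z\<^esub> ?b [^]\<^bsub>F125Z\<^esub> nat j \<in> carrier F125Z"
      by (intro F125Z.m_closed F125Z.nat_pow_closed gens)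
    then have "y = ?a [^]\<^bsub>F125Z\<^esub> nat i \<otimes>\<^bsub>F125Z\<^esub> ?b [^]\<^bsub>F125Z\<^esub> nat j"
      using F125Z_normal_form[of i j k] y(1) unfolding ijk \<open>k = 0\<close> int_pow_0
      by (simp only: F125Z.r_one)
    moreover have "nat i < 25" "nat j < 5" using y(1) by (auto simp: ijk carrier_F125Z)
    ultimately show ?thesis by blast
  qed
  moreover have "?a [^]\<^bsub>F125Z\<^esub> (25::nat) = \<one>\<^bsub>F125Z\<^esub>" "?a [^]\<^bsub>F125Z\<^esub> (5::nat) \<noteq> \<one>\<^bsub>F125Z\<^esub>"
    "?b [^]\<^bsub>F125Z\<^esub> (5::nat) = \<one>\<^bsub>F125Z\<^esub>"
    "?b \<otimes>\<^bsub>F125Z\<^esub> ?a = ?a [^]\<^bsub>F125Z\<^esub> (6::nat) \<otimes>\<^bsub>F125Z\<^esub> ?b"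
    by (simp_all add: pow_F125Z_base mult_F125Z one_F125Z)
  ultimately show ?thesis unfolding sat_torsion_sentence using gens by blast
qed

context
  fixes H :: "('a, 'b) monoid_scheme"
  assumes H: "group H" "elem_equiv H F125Z"
begin

lemma transfer: "fvars p = {} \<Longrightarrow> sat F125Z (\<lambda>_. \<one>\<^bsub>F125Z\<^esub>) p \<Longrightarrow> sat H (\<lambda>_. \<one>\<^bsub>H\<^esub>) p"
  using elem_equiv_sat_iff[OF group_F125Z H] by blast

text \<open>In \<open>F125Z\<close> a 25th power depends only on the integer coordinate, which is
  additive.\<close>

lemma transfer_pow_mult:
  assumes "x \<in> carrier H" "y \<in> carrier H"
  shows "(x \<otimes>\<^bsub>H\<^esub> y) [^]\<^bsub>H\<^esub> (25::nat) = x [^]\<^bsub>H\<^esub> (25::nat) \<otimes>\<^bsub>H\<^esub> y [^]\<^bsub>H\<^esub> (25::nat)"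
proof -
  let ?p = "Forall 0 (Forall 1 (Eq (Pow (Mult (Var 0) (Var 1)) 25)
    (Mult (Pow (Var 0) 25) (Pow (Var 1) 25))))"
  have "fvars ?p = {}" using tvars_Pow by fastforce
  moreover have "sat F125Z (\<lambda>_. \<one>\<^bsub>F125Z\<^esub>) ?p"
    by (auto simp: mult_F125Z carrier_F125Z pow25_F125Z)
  ultimately have "sat H (\<lambda>_. \<one>\<^bsub>H\<^esub>) ?p" by (rule transfer)
  then show ?thesis using assms by simp
qed

text \<open>In \<open>F125Z\<close> the central element \<open>(0, 0, k)\<close> has the same 25th
  power as \<open>(i, j, k)\<close>.\<close>

lemma transfer_central:
  assumes "y \<in> carrier H"
  shows "\<exists>z\<in>carrier H. z [^]\<^bsub>H\<^esub> (25::nat) = y [^]\<^bsub>H\<^esub> (25::nat) \<and>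
    (\<forall>w\<in>carrier H. z \<otimes>\<^bsub>H\<^esub> w = w \<otimes>\<^bsub>H\<^esub> z)"
proof -
  let ?p = "Forall 0 (Ex 1 (Conj (Eq (Pow (Var 1) 25) (Pow (Var 0) 25))
    (Forall 2 (Eq (Mult (Var 1) (Var 2)) (Mult (Var 2) (Var 1))))))"
  have "fvars ?p = {}" using tvars_Pow by fastforce
  moreover have "\<exists>z\<in>carrier F125Z. z [^]\<^bsub>F125Z\<^esub> (25::nat) = y [^]\<^bsub>F125Z\<^esub> (25::nat) \<and>
      (\<forall>w\<in>carrier F125Z. z \<otimes>\<^bsub>F125Z\<^esub> w = w \<otimes>\<^bsub>F125Z\<^esub> z)" if y: "y \<in> carrier F125Z" for y
  proof -
    obtain i j k where ijk: "y = (i, j, k)" by (rule prod_cases3)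
    have z: "(0, 0, k) \<in> carrier F125Z" by (simp add: carrier_F125Z)
    have "(0, 0, k) [^]\<^bsub>F125Z\<^esub> (25::nat) = y [^]\<^bsub>F125Z\<^esub> (25::nat)"
      using y z by (simp add: ijk pow25_F125Z)
    moreover have "\<forall>w\<in>carrier F125Z. (0, 0, k) \<otimes>\<^bsub>F125Z\<^esub> w = w \<otimes>\<^bsub>F125Z\<^esub> (0, 0, k)"
      by (auto simp: carrier_F125Z mult_F125Z)
    ultimately show ?thesis using z by blast
  qed
  then have "sat F125Z (\<lambda>_. \<one>\<^bsub>F125Z\<^esub>) ?p" by simp
  ultimately have "sat H (\<lambda>_. \<one>\<^bsub>H\<^esub>) ?p" by (rule transfer)
  then show ?thesis using assms by simp
qed

text \<open>One of \<open>k\<close>, \<open>k'\<close> and \<open>k + k'\<close> is even; half of it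
  is the integer coordinate of the witness \<open>z\<close>.\<close>

lemma transfer_parity:
  assumes "x \<in> carrier H" "y \<in> carrier H"
  shows "\<exists>z\<in>carrier H. x [^]\<^bsub>H\<^esub> (25::nat) = (z \<otimes>\<^bsub>H\<^esub> z) [^]\<^bsub>H\<^esub> (25::nat) \<or>
    y [^]\<^bsub>H\<^esub> (25::nat) = (z \<otimes>\<^bsub>H\<^esub> z) [^]\<^bsub>H\<^esub> (25::nat) \<or>
    (x \<otimes>\<^bsub>H\<^esub> y) [^]\<^bsub>H\<^esub> (25::nat) = (z \<otimes>\<^bsub>H\<^esub> z) [^]\<^bsub>H\<^esub> (25::nat)"
proof -
  let ?z = "Pow (Mult (Var 2) (Var 2)) 25"
  let ?p = "Forall 0 (Forall 1 (Ex 2 (Disj (Eq (Pow (Var 0) 25) ?z)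
    (Disj (Eq (Pow (Var 1) 25) ?z) (Eq (Pow (Mult (Var 0) (Var 1)) 25) ?z)))))"
  have "fvars ?p = {}" using tvars_Pow by fastforce
  moreover have "\<exists>z\<in>carrier F125Z. x [^]\<^bsub>F125Z\<^esub> (25::nat) = (z \<otimes>\<^bsub>F125Z\<^esub> z) [^]\<^bsub>F125Z\<^esub> (25::nat) \<or>
      y [^]\<^bsub>F125Z\<^esub> (25::nat) = (z \<otimes>\<^bsub>F125Z\<^esub> z) [^]\<^bsub>F125Z\<^esub> (25::nat) \<or>
      (x \<otimes>\<^bsub>F125Z\<^esub> y) [^]\<^bsub>F125Z\<^esub> (25::nat) = (z \<otimes>\<^bsub>F125Z\<^esub> z) [^]\<^bsub>F125Z\<^esub> (25::nat)"
    if xy: "x \<in> carrier F125Z" "y \<in> carrier F125Z" for x y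
  proof -
    obtain i j k where ijk: "x = (i, j, k)" by (rule prod_cases3)
    obtain i' j' k' where ijk': "y = (i', j', k')" by (rule prod_cases3)
    have sq: "((0, 0, l) \<otimes>\<^bsub>F125Z\<^esub> (0, 0, l)) [^]\<^bsub>F125Z\<^esub> (25::nat) = (0, 0, 25 * (2 * l))" for l
      by (simp add: mult_F125Z pow25_F125Z carrier_F125Z)
    have xy_pow: "(x \<otimes>\<^bsub>F125Z\<^esub> y) [^]\<^bsub>F125Z\<^esub> (25::nat) = (0, 0, 25 * (k + k'))"
      using xy by (simp add: ijk ijk' mult_F125Z pow25_F125Z carrier_F125Z)
    have "\<exists>l. k = 2 * l \<or> k' = 2 * l \<or> k + k' = 2 * l" by presburger
    then obtain l where "k = 2 * l \<or> k' = 2 * l \<or> k + k' = 2 * l" ..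
    then show ?thesis
      unfolding xy_pow using xy
      by (intro bexI[of _ "(0, 0, l)"]) (auto simp: sq ijk ijk' pow25_F125Z carrier_F125Z)
  qed
  then have "sat F125Z (\<lambda>_. \<one>\<^bsub>F125Z\<^esub>) ?p" by simp
  ultimately have "sat H (\<lambda>_. \<one>\<^bsub>H\<^esub>) ?p" by (rule transfer)
  then show ?thesis using assms by simp
qed

text \<open>Each \<open>m\<close> has its own sentence, as exponents cannot be quantified. In
  \<open>F125Z\<close> a torsion element has integer coordinate 0.\<close>

lemma transfer_exponent:
  assumes "y \<in> carrier H" "m > 0" "y [^]\<^bsub>H\<^esub> (m::nat) = \<one>\<^bsub>H\<^esub>"
  shows "y [^]\<^bsub>H\<^esub> (25::nat) = \<one>\<^bsub>H\<^esub>"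
proof -
  let ?p = "Forall 0 (Disj (Neg (Eq (Pow (Var 0) m) One)) (Eq (Pow (Var 0) 25) One))"
  have "fvars ?p = {}" using tvars_Pow by fastforce
  moreover have "y [^]\<^bsub>F125Z\<^esub> (25::nat) = \<one>\<^bsub>F125Z\<^esub>"
    if "y \<in> carrier F125Z" "y [^]\<^bsub>F125Z\<^esub> m = \<one>\<^bsub>F125Z\<^esub>" for y
  proof -
    obtain i j k where ijk: "y = (i, j, k)" by (rule prod_cases3)
    have "int m * k = 0" using that by (simp add: ijk pow_F125Z one_F125Z)
    then have "k = 0" using assms(2) by simp
    then show ?thesis using that(1) unfolding ijk one_F125Z by (simp only: pow25_F125Z) simp
  qed
  then have "sat F125Z (\<lambda>_. \<one>\<^bsub>F125Z\<^esub>) ?p" by auto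
  ultimately have "sat H (\<lambda>_. \<one>\<^bsub>H\<^esub>) ?p" by (rule transfer)
  then show ?thesis using assms by simp
qed

text \<open>This keeps the cyclic group of 25th powers from being trivial.\<close>

lemma transfer_infinite: "\<exists>y\<in>carrier H. y [^]\<^bsub>H\<^esub> (25::nat) \<noteq> \<one>\<^bsub>H\<^esub>"
proof -
  let ?p = "Ex 0 (Neg (Eq (Pow (Var 0) 25) One))"
  have "fvars ?p = {}" using tvars_Pow by fastforce
  moreover have "(0, 0, 1) [^]\<^bsub>F125Z\<^esub> (25::nat) \<noteq> \<one>\<^bsub>F125Z\<^esub>" "(0, 0, 1) \<in> carrier F125Z"
    by (simp_all add: pow25_F125Z carrier_F125Z one_F125Z)
  then have "sat F125Z (\<lambda>_. \<one>\<^bsub>F125Z\<^esub>) ?p" by auto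
  ultimately have "sat H (\<lambda>_. \<one>\<^bsub>H\<^esub>) ?p" by (rule transfer)
  then show ?thesis by simp
qed

lemma elem_equiv_F125Z_imp_iso:
  assumes fg: "fin_gen H"
  shows "H \<cong> F125Z"
proof -
  interpret H: group H by (rule H(1))
  have "sat H (\<lambda>_. \<one>\<^bsub>H\<^esub>) torsion_sentence"
    using fvars_torsion_sentence torsion_sentence_F125Z by (rule transfer)
  then obtain a b where ab: "a \<in> carrier H" "b \<in> carrier H" "a [^]\<^bsub>H\<^esub> (25::nat) = \<one>\<^bsub>H\<^esub>"
    "a [^]\<^bsub>H\<^esub> (5::nat) \<noteq> \<one>\<^bsub>H\<^esub>" "b [^]\<^bsub>H\<^esub> (5::nat) = \<one>\<^bsub>H\<^esub>"
    "b \<otimes>\<^bsub>H\<^esub> a = a [^]\<^bsub>H\<^esub> (6::nat) \<otimes>\<^bsub>H\<^esub> b"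
    and torsion: "\<And>y. y \<in> carrier H \<Longrightarrow> y [^]\<^bsub>H\<^esub> (25::nat) = \<one>\<^bsub>H\<^esub> \<Longrightarrow>
      \<exists>i<25. \<exists>j<5. y = a [^]\<^bsub>H\<^esub> (i::nat) \<otimes>\<^bsub>H\<^esub> b [^]\<^bsub>H\<^esub> (j::nat)"
    unfolding sat_torsion_sentence by blast
  have "F125Z \<cong> H"
    using fg ab(1,3,4,2,5,6) torsion transfer_pow_mult transfer_central transfer_parity
      transfer_exponent transfer_infinite
    by (rule H.F125Z_iso)
  then show ?thesis by (rule F125Z.iso_sym)
qed

end

section \<open>Transport to an isomorphic copy and conclusion\<close>

text \<open>Rigidity is established for \<open>F125Z\<close> and carried by this to its copy on the
  natural numbers.\<close>

lemma first_order_rigid_iso: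
  assumes "group G" "group H" "G \<cong> H" and fg: "fin_gen G"
    and rigid: "\<And>K :: nat monoid. group K \<Longrightarrow> fin_gen K \<Longrightarrow> elem_equiv K G \<Longrightarrow> K \<cong> G"
  shows "first_order_rigid H"
  unfolding first_order_rigid_def
proof (intro conjI allI impI)
  obtain f where "f \<in> iso G H" using assms(3) by (auto simp: is_iso_def)
  then show "fin_gen H" using fin_gen_iso[OF assms(1,2)] fg by blast
next
  fix K :: "nat monoid" assume K: "group K" "fin_gen K" "elem_equiv K H"
  have "elem_equiv K G"
    using elem_equiv_iso[OF assms(1-3)] K(3) by (simp add: elem_equiv_def)
  then show "K \<cong> H" using rigid[OF K(1,2)] assms(3) iso_trans by blast
qed (rule assms(2))

text \<open>An isomorphism maps the right cosets of \<open>H\<close> onto those of its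
  image.\<close>

lemma finite_index_subgroup_image:
  assumes "group G" "group K" and f: "f \<in> iso G K" and H: "finite_index_subgroup H G"
  shows "finite_index_subgroup (f ` H) K"
proof -
  interpret f: group_hom G K f
    using assms by (auto simp: group_hom_def group_hom_axioms_def iso_def)
  have sub: "subgroup H G" using H by (simp add: finite_index_subgroup_def)
  then have HG: "H \<subseteq> carrier G" by (rule subgroup.subset)
  have coset: "f ` H #>\<^bsub>K\<^esub> f x = f ` (H #>\<^bsub>G\<^esub> x)" if "x \<in> carrier G" for x
  proof -
    have "f ` H #>\<^bsub>K\<^esub> f x = (\<Union>h\<in>H. {f h \<otimes>\<^bsub>K\<^esub> f x})" by (auto simp: r_coset_def)
    also have "\<dots> = (\<Union>h\<in>H. {f (h \<otimes>\<^bsub>G\<^esub> x)})"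
      by (rule SUP_cong) (use HG that f.hom_mult in auto)
    also have "\<dots> = f ` (H #>\<^bsub>G\<^esub> x)" by (auto simp: r_coset_def)
    finally show ?thesis .
  qed
  have "carrier K = f ` carrier G" using f by (simp add: iso_iff)
  then have "rcosets\<^bsub>K\<^esub> (f ` H) \<subseteq> (`) f ` (rcosets\<^bsub>G\<^esub> H)"
    by (auto simp: RCOSETS_def coset)
  then show ?thesis
    using H f.subgroup_img_is_subgroup[OF sub] finite_subset
    unfolding finite_index_subgroup_def by blast
qed

lemma (in group_hom) iso_image:
  assumes "inj_on h (carrier G)"
  shows "G \<cong> H\<lparr>carrier := h ` carrier G\<rparr>"
proof (rule is_isoI)
  show "h \<in> iso G (H\<lparr>carrier := h ` carrier G\<rparr>)"
    using assms by (auto simp: iso_def hom_def bij_betw_def)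
qed

theorem proposition6p5:
  shows "\<exists>(\<Gamma> :: nat monoid) H. first_order_rigid \<Gamma> \<and> finite_index_subgroup H \<Gamma> \<and>
    G6 \<cong> \<Gamma>\<lparr>carrier := H\<rparr>"
proof -
  \<comment> \<open>\<open>F125Z\<close> is finitely generated, hence countable, so it has a copy of
    the required type.\<close>
  obtain \<Gamma> :: "nat monoid" where \<Gamma>: "group \<Gamma>" "F125Z \<cong> \<Gamma>"
    using countable_group_nat_copy[OF group_F125Z fin_gen_countable[OF group_F125Z fin_gen_F125Z]] .
  then obtain f where f: "f \<in> iso F125Z \<Gamma>" by (auto simp: is_iso_def)
  let ?g = "f \<circ> G6_emb"
  have "?g \<in> hom G6 \<Gamma>" using G6_emb_hom f by (auto intro: hom_compose simp: iso_def)
  then interpret g: group_hom G6 \<Gamma> ?g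
    by (intro group_hom.intro group_hom_axioms.intro group_G6 \<Gamma>(1))
  have "inj_on ?g (carrier G6)"
  proof (rule comp_inj_on[OF inj_G6_emb])
    have "inj_on f (carrier F125Z)" using f by (simp add: iso_iff)
    moreover have "G6_emb ` carrier G6 \<subseteq> carrier F125Z" using G6_emb_hom by (auto simp: hom_def)
    ultimately show "inj_on f (G6_emb ` carrier G6)" by (rule inj_on_subset)
  qed
  then have "G6 \<cong> \<Gamma>\<lparr>carrier := ?g ` carrier G6\<rparr>" by (rule g.iso_image)
  moreover have "finite_index_subgroup (?g ` carrier G6) \<Gamma>"
    using finite_index_subgroup_image[OF group_F125Z \<Gamma>(1) f finite_index_G6_emb]
    by (simp only: image_comp)
  moreover have "first_order_rigid \<Gamma>"
    using group_F125Z \<Gamma> fin_gen_F125Z elem_equiv_F125Z_imp_iso by (rule first_order_rigid_iso)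
  ultimately show ?thesis by blast
qed

end
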